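(* Let $d,m,N$ be positive integers, $0<\Lambda_1<\dots<\Lambda_N$, $A_1,\dots,A_N\in\mathbb{R}^{d\times d}$, $B\in\mathbb{R}^{d\times m}$, $g\in L^\infty([0,\Lambda_N],\mathbb{R}^{d\times d})$, $q\in[1,+\infty)$. The input-output system $$\begin{cases} x(t)=\sum_{j=1}^N A_j x(t-\Lambda_j)+\int_0^{\Lambda_N} g(s)x(t-s)\,ds+Bu(t), & t\ge \inf\operatorname{supp}(u),\\ x(t)=0, & t<\inf\operatorname{supp}(u),\\ y(t)=x(t-\Lambda_N), & t\ge 0,\end{cases}$$ with inputs $u\in\Omega_q:=\{u\in L^q(\mathbb{R},\mathbb{R}^m): \operatorname{supp}(u)\subseteq\mathbb{R}_- \text{ is compact}\}$, is pseudo-rational of order zero.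
   Context: $\mathcal{E}'(\mathbb{R}_-)$ denotes the distributions on $\mathbb{R}$ with compact support contained in $\mathbb{R}_-=(-\infty,0]$, and $\mathcal{D}'_+(\mathbb{R})$ the distributions with support bounded on the left, which is an algebra under convolution $*$; $\delta_x$ is the Dirac mass at $x$. For $\phi\in L^q_{\rm loc}(\mathbb{R},\mathbb{R}^d)$, $\pi(\phi)$ denotes its restriction to $[0,+\infty)$. The system is called pseudo-rational of order zero if there exist a $d\times d$ matrix $Q$ and a $d\times m$ matrix $P$, both with entries in $\mathcal{E}'(\mathbb{R}_-)$, such that (1) $Q$ has a convolution inverse $Q^{-1}$, a $d\times d$ matrix with entries in $\mathcal{D}'_+(\mathbb{R})$ with $Q^{-1}*Q=Q*Q^{-1}=\delta_0 I_d$, and the distribution $\det(Q^{-1})$ has order zero; (2) for every input $u\in\Omega_q$ the output satisfies $y=\pi(Q^{-1}*P*u)$. *)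

theory Defs
  imports "HOL-Analysis.Analysis" "HOL-Combinatorics.Permutations"
begin

type_synonym distr = "(real \<Rightarrow> real) \<Rightarrow> real"

definition tsupp :: "(real \<Rightarrow> real) \<Rightarrow> real set" where
  "tsupp f = closure {x. f x \<noteq> 0}"

definition smooth_fun :: "(real \<Rightarrow> real) \<Rightarrow> bool" where
  "smooth_fun f \<longleftrightarrow> (\<forall>k x. ((deriv ^^ k) f) differentiable (at x))"

definition test_fun :: "(real \<Rightarrow> real) \<Rightarrow> bool" where
  "test_fun f \<longleftrightarrow> smooth_fun f \<and> compact (tsupp f)"

text \<open>Distributions: linear functionals on test functions, continuous in the usual
  inductive-limit sense (seminorm estimate on each compact interval).\<close>
definition is_distr :: "distr \<Rightarrow> bool" where
  "is_distr T \<longleftrightarrow>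
     (\<forall>\<phi> \<psi>. test_fun \<phi> \<longrightarrow> test_fun \<psi> \<longrightarrow> T (\<lambda>x. \<phi> x + \<psi> x) = T \<phi> + T \<psi>) \<and>
     (\<forall>c \<phi>. test_fun \<phi> \<longrightarrow> T (\<lambda>x. c * \<phi> x) = c * T \<phi>) \<and>
     (\<forall>a b. \<exists>C k. \<forall>\<phi>. test_fun \<phi> \<longrightarrow> tsupp \<phi> \<subseteq> {a..b} \<longrightarrow>
         \<bar>T \<phi>\<bar> \<le> C * (\<Sum>j\<le>(k::nat). Sup (range (\<lambda>x. \<bar>(deriv ^^ j) \<phi> x\<bar>))))"

definition supp_ge :: "distr \<Rightarrow> real \<Rightarrow> bool" where
  "supp_ge T a \<longleftrightarrow> (\<forall>\<phi>. test_fun \<phi> \<longrightarrow> tsupp \<phi> \<inter> {a..} = {} \<longrightarrow> T \<phi> = 0)"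

definition distr_plus :: "distr \<Rightarrow> bool" where
  "distr_plus T \<longleftrightarrow> is_distr T \<and> (\<exists>a. supp_ge T a)"

definition distr_cpt_neg :: "distr \<Rightarrow> bool" where
  "distr_cpt_neg T \<longleftrightarrow> is_distr T \<and>
     (\<exists>a. \<forall>\<phi>. test_fun \<phi> \<longrightarrow> tsupp \<phi> \<inter> {a..0} = {} \<longrightarrow> T \<phi> = 0)"

definition distr_eq :: "distr \<Rightarrow> distr \<Rightarrow> bool" where
  "distr_eq S T \<longleftrightarrow> (\<forall>\<phi>. test_fun \<phi> \<longrightarrow> S \<phi> = T \<phi>)"

definition distr_order_zero :: "distr \<Rightarrow> bool" where
  "distr_order_zero T \<longleftrightarrow> (\<forall>a b. \<exists>C. \<forall>\<phi>. test_fun \<phi> \<longrightarrow> tsupp \<phi> \<subseteq> {a..b} \<longrightarrow>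
       \<bar>T \<phi>\<bar> \<le> C * Sup (range (\<lambda>x. \<bar>\<phi> x\<bar>)))"

definition dirac0 :: distr where "dirac0 \<phi> = \<phi> 0"

definition zero_distr :: distr where "zero_distr \<phi> = 0"

definition fun_distr :: "(real \<Rightarrow> real) \<Rightarrow> distr" where
  "fun_distr f \<phi> = (LINT t|lborel. f t * \<phi> t)"

text \<open>Convolution in \<D>'_+: \<langle>S*T,\<phi>\<rangle> = \<langle>S_x, chi1(x) \<langle>T_y, chi2(y) \<phi>(x+y)\<rangle>\<rangle>
  with cutoffs equal to one on the relevant compact sets (the value does not depend on
  the admissible choices).\<close>
definition conv :: "distr \<Rightarrow> distr \<Rightarrow> distr" where
  "conv S T \<phi> =
     (let (a, b, c, \<chi>1, \<chi>2) = (SOME (a, b, c, \<chi>1, \<chi>2).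
          supp_ge S a \<and> supp_ge T b \<and> tsupp \<phi> \<subseteq> {..c} \<and>
          test_fun \<chi>1 \<and> test_fun \<chi>2 \<and>
          (\<forall>x\<in>{a-1..c-b+1}. \<chi>1 x = 1) \<and> (\<forall>y\<in>{b-1..c-a+1}. \<chi>2 y = 1))
      in S (\<lambda>x. \<chi>1 x * T (\<lambda>y. \<chi>2 y * \<phi> (x + y))))"

definition mconv :: "('i \<Rightarrow> 'j::finite \<Rightarrow> distr) \<Rightarrow> ('j \<Rightarrow> 'k \<Rightarrow> distr) \<Rightarrow> 'i \<Rightarrow> 'k \<Rightarrow> distr" where
  "mconv A B i k = (\<lambda>\<phi>. \<Sum>j\<in>UNIV. conv (A i j) (B j k) \<phi>)"

definition mvconv :: "('i \<Rightarrow> 'j::finite \<Rightarrow> distr) \<Rightarrow> ('j \<Rightarrow> distr) \<Rightarrow> 'i \<Rightarrow> distr" where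
  "mvconv A v i = (\<lambda>\<phi>. \<Sum>j\<in>UNIV. conv (A i j) (v j) \<phi>)"

definition dirac_id :: "'i \<Rightarrow> 'i \<Rightarrow> distr" where
  "dirac_id i j = (if i = j then dirac0 else zero_distr)"

text \<open>Convolution product of a finite family (order irrelevant: \<D>'_+ is commutative).\<close>
definition conv_prod :: "('i::finite \<Rightarrow> distr) \<Rightarrow> distr" where
  "conv_prod F = foldr conv (map F (SOME xs. distinct xs \<and> set xs = (UNIV :: 'i set))) dirac0"

definition distr_det :: "('i::finite \<Rightarrow> 'i \<Rightarrow> distr) \<Rightarrow> distr" where
  "distr_det M = (\<lambda>\<phi>. \<Sum>p | p permutes (UNIV :: 'i set).
                     of_int (sign p) * conv_prod (\<lambda>i. M i (p i)) \<phi>)"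

definition Omega_q :: "real \<Rightarrow> (real \<Rightarrow> real^'m) set" where
  "Omega_q q = {u. u \<in> borel_measurable lborel \<and> integrable lborel (\<lambda>t. norm (u t) powr q) \<and>
                    (\<exists>a. AE t in lborel. (t < a \<or> t > 0) \<longrightarrow> u t = 0)}"

definition Lq_loc :: "real \<Rightarrow> (real \<Rightarrow> real^'d) \<Rightarrow> bool" where
  "Lq_loc q x \<longleftrightarrow> x \<in> borel_measurable lborel \<and>
     (\<forall>a b. set_integrable lborel {a..b} (\<lambda>t. norm (x t) powr q))"

text \<open>Set of times t with u = 0 a.e. on (-\<infinity>,t), i.e.
  (-\<infinity>, inf supp u] (all of \<real> when u = 0 a.e.).\<close>
definition before_supp :: "(real \<Rightarrow> real^'m) \<Rightarrow> real set" where
  "before_supp u = {t. AE s in lborel. s < t \<longrightarrow> u s = 0}"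

definition is_solution ::
  "real \<Rightarrow> nat \<Rightarrow> (nat \<Rightarrow> real) \<Rightarrow> (nat \<Rightarrow> real^'d^'d) \<Rightarrow> (real \<Rightarrow> real^'d^'d) \<Rightarrow>
   real^'m^'d \<Rightarrow> (real \<Rightarrow> real^'m) \<Rightarrow> (real \<Rightarrow> real^'d) \<Rightarrow> bool" where
  "is_solution q N \<Lambda> A g B u x \<longleftrightarrow> Lq_loc q x \<and>
     (AE t in lborel. t \<in> before_supp u \<longrightarrow> x t = 0) \<and>
     (AE t in lborel. t \<notin> before_supp u \<longrightarrow>
        x t = (\<Sum>j=1..N. A j *v x (t - \<Lambda> j))
              + (LINT s:{0..\<Lambda> N}|lborel. g s *v x (t - s)) + B *v u t)"

end

theory Submission
  imports Defs
begin

text \<open>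
  Put L = \<Lambda> N. The system equation says that x minus the delay operator applied to x equals B u,
  so Q is the kernel of this equation translated by - L, and P is B times the Dirac mass at 0.
  Convolution with a distribution T acts on test functions through the correlation
  x \<mapsto> T (\<lambda>y. \<phi> (x + y)); the one of the kernel is \<psi> \<mapsto> \<psi> - K \<psi> with
  K \<psi> x = \<Sum>j. A j \<psi> (x + \<Lambda> j) + \<integral> g s \<psi> (x + s) ds. In the weight exp (\<lambda> x) with \<lambda> large, K is a
  contraction with constant 1/2 on functions vanishing near + infinity, and this holds on every
  half-line [a, infinity) separately. Banach's fixed point theorem therefore gives the inverse, and
  the half-line estimate gives uniqueness, locality (support bounded on the left) and a sup norm bound,
  that is, order zero. Order zero is preserved by convolution, whence the claim on the determinant.
  Finally, the correlation of a test function with a solution x solves the resolvent equation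
  whose right-hand side is its correlation with B u, by Fubini.
\<close>

section \<open>Smooth functions\<close>

text \<open>As \<open>conv\<close> picks its cutoffs by choice, it can be computed only after
  independence of them is known, and this requires
  \<open>x \<mapsto> w1 x * T (\<lambda>y. w2 y * \<phi> (x + y))\<close> to be a test function.
  Order zero keeps this elementary: one uniform Taylor remainder replaces seminorm estimates, and
  every distribution occurring below has order zero. The inverse is built as a functional, not as a
  series of Dirac masses and densities. Testing moves the delays onto the test function, where they
  become advances. The equation is therefore solved backwards from + infinity, where test functions
  vanish, and a growing weight exp (\<lambda> x) fits that direction: an advance by s costs a factor
  exp (- \<lambda> s). Contraction needs point delays bounded away from 0, which finitely many
  positive delays guarantee, while the bounded density g contributes at most a multiple of 1 /
  \<lambda>. The translation by - L serves twice. It moves the support of the kernel from [0, L]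
  into [- L, 0], as the entries of Q demand, and it delays the inverse by L, matching y(t) = x(t -
  L).\<close>

fun diff_upto :: "nat \<Rightarrow> (real \<Rightarrow> real) \<Rightarrow> bool" where
  "diff_upto 0 f \<longleftrightarrow> (\<forall>x. f differentiable (at x))"
| "diff_upto (Suc k) f \<longleftrightarrow> (\<forall>x. f differentiable (at x)) \<and> diff_upto k (deriv f)"

lemma diff_upto_differentiable: "diff_upto k f \<Longrightarrow> f differentiable (at x)"
  by (cases k) auto

lemma diff_upto_DERIV: "diff_upto k f \<Longrightarrow> (f has_real_derivative deriv f x) (at x)"
  using diff_upto_differentiable DERIV_deriv_iff_real_differentiable by blast

lemma diff_upto_Suc_imp: "diff_upto (Suc k) f \<Longrightarrow> diff_upto k f"
  by (induction k arbitrary: f) auto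

text \<open>\<open>diff_upto\<close> peels off the first derivative, so closure properties go by
  induction on the order with the function generalized; iterating \<open>deriv\<close> from the
  outside would not fit the product and chain rules. This is the only passage between the two
  forms.\<close>

lemma diff_upto_iff: "diff_upto k f \<longleftrightarrow> (\<forall>j\<le>k. \<forall>x. ((deriv ^^ j) f) differentiable (at x))"
proof (induction k arbitrary: f)
  case (Suc k)
  have "(\<forall>j\<le>Suc k. \<forall>x. ((deriv ^^ j) f) differentiable (at x)) \<longleftrightarrow>
      (\<forall>x. f differentiable (at x)) \<and> (\<forall>j\<le>k. \<forall>x. ((deriv ^^ Suc j) f) differentiable (at x))"
    (is "?L \<longleftrightarrow> ?R")
  proof
    assume L: ?L
    have "f differentiable (at x)" for x
      using L[rule_format, of 0 x] by simp
    then show ?R using L by auto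
  next
    assume R: ?R
    have "((deriv ^^ j) f) differentiable (at x)" if "j \<le> Suc k" for j x
      using R that by (cases j) auto
    then show ?L by blast
  qed
  then show ?case using Suc[of "deriv f"] by (simp add: funpow_swap1)
qed simp

lemma smooth_fun_iff: "smooth_fun f \<longleftrightarrow> (\<forall>k. diff_upto k f)"
  unfolding smooth_fun_def diff_upto_iff by auto

text \<open>Lets the closure rules name an explicit derivative: uniqueness of derivatives makes it
  equal to \<open>deriv f\<close> as a function.\<close>

lemma diff_upto_SucI:
  assumes "\<And>x. (f has_real_derivative f' x) (at x)" "diff_upto k f'"
  shows "diff_upto (Suc k) f"
proof -
  have "deriv f = f'" using assms(1) by (auto intro: DERIV_imp_deriv)
  then show ?thesis using assms by (auto simp: real_differentiable_def)
qed

lemma diff_upto_const: "diff_upto k (\<lambda>x. c)"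
proof (induction k arbitrary: c)
  case (Suc k)
  show ?case by (rule diff_upto_SucI[where f' = "\<lambda>x. 0"]) (auto intro: Suc)
qed simp

lemma diff_upto_add: "diff_upto k f \<Longrightarrow> diff_upto k g \<Longrightarrow> diff_upto k (\<lambda>x. f x + g x)"
proof (induction k arbitrary: f g)
  case (Suc k)
  show ?case
    by (rule diff_upto_SucI[where f' = "\<lambda>x. deriv f x + deriv g x"])
       (use Suc in \<open>auto intro!: DERIV_add diff_upto_DERIV[of "Suc k"]\<close>)
qed simp

lemma diff_upto_mult: "diff_upto k f \<Longrightarrow> diff_upto k g \<Longrightarrow> diff_upto k (\<lambda>x. f x * g x)"
proof (induction k arbitrary: f g)
  case (Suc k)
  have fg: "diff_upto k f" "diff_upto k g" using Suc.prems diff_upto_Suc_imp by blast+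
  have "diff_upto k (\<lambda>x. deriv f x * g x + deriv g x * f x)"
    using Suc.prems fg by (intro diff_upto_add Suc.IH) auto
  then show ?case
    by (intro diff_upto_SucI[where f' = "\<lambda>x. deriv f x * g x + deriv g x * f x"])
       (use Suc.prems in \<open>auto intro!: DERIV_mult diff_upto_DERIV[of "Suc k"]\<close>)
qed simp

lemma diff_upto_affine: "diff_upto k f \<Longrightarrow> diff_upto k (\<lambda>x. f (c * x + d))"
proof (induction k arbitrary: f)
  case 0
  have "((\<lambda>x. f (c * x + d)) has_real_derivative deriv f (c * x + d) * c) (at x)" for x
    by (rule DERIV_chain2[where f =
        f]) (use 0 in \<open>auto intro!: diff_upto_DERIV[of 0] derivative_eq_intros\<close>)
  then show ?case by (auto simp: real_differentiable_def)
next
  case (Suc k)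
  have "diff_upto k (\<lambda>x. deriv f (c * x + d) * c)"
    using Suc by (intro diff_upto_mult diff_upto_const) auto
  moreover have "((\<lambda>x. f (c * x + d)) has_real_derivative deriv f (c * x + d) * c) (at x)" for x
    by (rule DERIV_chain2[where f = f])
       (use Suc.prems in \<open>auto intro!: diff_upto_DERIV[of "Suc k"] derivative_eq_intros\<close>)
  ultimately show ?case by (rule diff_upto_SucI[rotated])
qed

lemma diff_upto_inverse:
  assumes "\<And>x. g x \<noteq> 0"
  shows "diff_upto k g \<Longrightarrow> diff_upto k (\<lambda>x. inverse (g x))"
proof (induction k)
  case 0
  then show ?case using assms by (auto intro!: differentiable_inverse)
next
  case (Suc k)
  have 1: "diff_upto k (\<lambda>x. inverse (g x))"
    using Suc diff_upto_Suc_imp by blast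
  have "diff_upto k (\<lambda>x. (-1) * (inverse (g x) * deriv g x * inverse (g x)))"
    using Suc.prems by (intro diff_upto_mult diff_upto_const 1) auto
  moreover have "((\<lambda>x. inverse (g x)) has_real_derivative
      (-1) * (inverse (g x) * deriv g x * inverse (g x))) (at x)" for x
    using DERIV_inverse'[OF diff_upto_DERIV[OF Suc.prems] assms] by simp
  ultimately show ?case by (rule diff_upto_SucI[rotated])
qed

section \<open>Flat functions and the smooth step\<close>

text \<open>The family is closed under differentiation, which makes its smoothness an induction.\<close>

definition exp_flat :: "nat \<Rightarrow> real \<Rightarrow> real" where
  "exp_flat n x = (if x > 0 then exp (- inverse x) * inverse x ^ n else 0)"

text \<open>The left side is a single term of the exponential series, whose terms are nonnegative
  here.\<close>

lemma power_over_fact_le_exp: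
  fixes y :: real
  assumes "y \<ge> 0"
  shows "y ^ m / fact m \<le> exp y"
proof -
  have "(\<Sum>n\<in>{m}. y ^ n /\<^sub>R fact n) \<le> exp y"
    using assms sums_unique[OF exp_converges[of y]] sums_summable[OF exp_converges[of y]]
    by (subst sums_unique[OF exp_converges[of y]], intro sum_le_suminf) auto
  then show ?thesis by (simp add: field_simps)
qed

text \<open>With y = 1 / x, the exponential beats y to the power n + 2, and multiplying by the
  square of x removes the two surplus powers. The square is what makes the function differentiable
  at 0 with derivative 0.\<close>

lemma exp_flat_bound: "\<bar>exp_flat n x\<bar> \<le> fact (n + 2) * x\<^sup>2"
proof (cases "x > 0")
  case True
  define y where "y = inverse x"
  have y: "y > 0" using True by (simp add: y_def)
  have "y ^ (n+2) \<le> fact (n+2) * exp y"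
    using power_over_fact_le_exp[of y "n+2"] y fact_gt_zero[of "n+2", where 'a = real]
    by (simp only: pos_divide_le_eq mult.commute less_imp_le)
  then have "exp (-y) * y ^ (n+2) \<le> exp (-y) * (fact (n+2) * exp y)"
    by (intro mult_left_mono) auto
  also have "\<dots> = fact (n+2)" by (simp add: exp_minus)
  finally have "exp (-y) * y ^ (n+2) * x\<^sup>2 \<le> fact (n+2) * x\<^sup>2"
    by (intro mult_right_mono) auto
  moreover have "exp (-y) * y ^ (n+2) * x\<^sup>2 = exp (-y) * y ^ n"
    using True by (simp add: y_def power_add power2_eq_square field_simps)
  ultimately have "exp (-y) * y ^ n \<le> fact (n+2) * x\<^sup>2" by (simp only:)
  then show ?thesis using True by (simp add: exp_flat_def y_def del: fact_Suc)
qed (auto simp: exp_flat_def)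

text \<open>Dividing the remainder by h leaves at most K times the modulus of h. The criterion
  serves twice: at the gluing point of \<open>exp_flat\<close> and for functionals applied to
  shifted test functions.\<close>

lemma DERIV_quadratic_remainder:
  fixes f :: "real \<Rightarrow> real"
  assumes "\<And>h. \<bar>f (x + h) - f x - h * D\<bar> \<le> K * h\<^sup>2"
  shows "(f has_real_derivative D) (at x)"
proof -
  have "(\<lambda>h. (f (x + h) - f x) / h - D) \<midarrow>0\<rightarrow> 0"
  proof (rule Lim_null_comparison)
    have "norm ((f (x + h) - f x) / h - D) \<le> K * \<bar>h\<bar>" if "h \<noteq> 0" for h
    proof -
      have "(f (x + h) - f x) / h - D = (f (x + h) - f x - h * D) / h"
        using that by (simp add: field_simps)
      then have "norm ((f (x + h) - f x) / h - D) = \<bar>f (x + h) - f x - h * D\<bar> / \<bar>h\<bar>"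
        by (simp add: abs_divide)
      also have "\<dots> \<le> K * h\<^sup>2 / \<bar>h\<bar>" by (intro divide_right_mono assms) auto
      also have "\<dots> = K * \<bar>h\<bar>" using that by (simp add: power2_eq_square field_simps flip: abs_mult)
      finally show ?thesis .
    qed
    then show "\<forall>\<^sub>F h in at 0. norm ((f (x + h) - f x) / h - D) \<le> K * \<bar>h\<bar>"
      by (auto simp: eventually_at_filter)
    show "((\<lambda>h. K * \<bar>h\<bar>) \<longlongrightarrow> 0) (at (0::real))"
      by (auto intro!: tendsto_eq_intros)
  qed
  then show ?thesis unfolding DERIV_def by (rule LIM_zero_cancel)
qed

text \<open>For x > 0 the inner derivative of exp (- 1 / x) contributes two powers of 1 / x, and the
  power itself contributes one power with factor - n. For n = 0 the exponent n - 1 truncates, but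
  its coefficient is 0.\<close>

lemma exp_flat_DERIV:
  "(exp_flat n has_real_derivative (exp_flat (n + 2) x + (- real n) * exp_flat (n + 1) x)) (at x)"
proof -
  consider "x > 0" | "x < 0" | "x = 0" by linarith
  then show ?thesis
  proof cases
    case 1
    have "((\<lambda>x. exp (- inverse x) * inverse x ^ n) has_real_derivative
        (exp_flat (n + 2) x + (- real n) * exp_flat (n + 1) x)) (at x)"
    proof -
      define y where "y = inverse x"
      have E: "((\<lambda>x. exp (- inverse x)) has_real_derivative exp (- y) * y\<^sup>2) (at x)"
        using 1 by (auto intro!: derivative_eq_intros simp: y_def power2_eq_square)
      have "((\<lambda>x. inverse x ^ n) has_real_derivative real n * (- y\<^sup>2 * y ^ (n - 1))) (at x)"
        using 1 DERIV_power[OF DERIV_inverse, of x n UNIV]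
        by (simp add: y_def numeral_2_eq_2 power_inverse)
      from DERIV_mult[OF E this]
      have "((\<lambda>x. exp (- inverse x) * inverse x ^ n) has_real_derivative
          exp (- y) * y\<^sup>2 * y ^ n + real n * (- y\<^sup>2 * y ^ (n - 1)) * exp (- y)) (at x)"
        by (simp only: y_def)
      moreover have "exp (- y) * y\<^sup>2 * y ^ n + real n * (- y\<^sup>2 * y ^ (n - 1)) * exp (- y)
          = exp_flat (n + 2) x + (- real n) * exp_flat (n + 1) x"
        using 1 by (cases n) (simp_all add: exp_flat_def y_def[symmetric] power2_eq_square algebra_simps)
      ultimately show ?thesis by simp
    qed
    then show ?thesis
      by (rule has_field_derivative_transform_within_open[of _ _ _ "{0<..}"])
         (use 1 in \<open>auto simp: exp_flat_def\<close>)
  next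
    case 2
    have "((\<lambda>x. 0) has_real_derivative 0) (at x)" by simp
    then have "(exp_flat n has_real_derivative 0) (at x)"
      by (rule has_field_derivative_transform_within_open[of _ _ _ "{..<0}"])
         (use 2 in \<open>auto simp: exp_flat_def\<close>)
    then show ?thesis using 2 by (simp add: exp_flat_def)
  next
    case 3
    \<comment> \<open>At 0 both the value and the claimed derivative are 0, so the remainder is
      \<open>exp_flat n\<close> itself.\<close>
    then show ?thesis
      using exp_flat_bound[of n]
      by (intro DERIV_quadratic_remainder[where K = "fact (n + 2)"]) (simp add: exp_flat_def)
  qed
qed

lemma diff_upto_exp_flat: "diff_upto k (exp_flat n)"
proof (induction k arbitrary: n)
  case 0
  show ?case using exp_flat_DERIV by (auto simp: real_differentiable_def)
next
  case (Suc k)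
  show ?case
    by (rule diff_upto_SucI[OF exp_flat_DERIV])
       (intro diff_upto_add diff_upto_mult diff_upto_const Suc.IH)
qed

text \<open>The classical quotient f(x) / (f(x) + f(1 - x)), whose denominator is positive because x
  or 1 - x is. The spelling \<open>(-1) * x + 1\<close> matches the shape of
  \<open>diff_upto_affine\<close>.\<close>

definition smooth_step :: "real \<Rightarrow> real" where
  "smooth_step x = exp_flat 0 x * inverse (exp_flat 0 x + exp_flat 0 ((-1) * x + 1))"

lemma diff_upto_smooth_step: "diff_upto k smooth_step"
proof -
  have nz: "exp_flat 0 x + exp_flat 0 ((-1) * x + 1) \<noteq> 0" for x
  proof -
    have "exp_flat 0 z \<ge> 0" for z by (simp add: exp_flat_def)
    moreover have "exp_flat 0 x > 0 \<or> exp_flat 0 ((-1) * x + 1) > 0"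
      by (auto simp: exp_flat_def)
    ultimately show ?thesis by (metis add_nonneg_eq_0_iff less_irrefl)
  qed
  show ?thesis unfolding smooth_step_def[abs_def]
    by (intro diff_upto_mult diff_upto_inverse[OF nz] diff_upto_add diff_upto_affine diff_upto_exp_flat)
qed

lemma smooth_step_0: "x \<le> 0 \<Longrightarrow> smooth_step x = 0"
  and smooth_step_1: "x \<ge> 1 \<Longrightarrow> smooth_step x = 1"
  by (auto simp: smooth_step_def exp_flat_def)

section \<open>Test functions\<close>

lemma tsupp_subset: "closed S \<Longrightarrow> (\<And>x. x \<notin> S \<Longrightarrow> f x = 0) \<Longrightarrow> tsupp f \<subseteq> S"
  unfolding tsupp_def by (rule closure_minimal) auto

lemma tsupp_zero: "x \<notin> tsupp f \<Longrightarrow> f x = 0"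
  unfolding tsupp_def using closure_subset[of "{x. f x \<noteq> 0}"] by auto

text \<open>On the line, a closure is compact iff the set itself is bounded. Later arguments can
  thus bound the nonzeros of a function and need no closures.\<close>

lemma test_fun_iff:
  "test_fun f \<longleftrightarrow> (\<forall>k. diff_upto k f) \<and> (\<exists>a b. \<forall>x. f x \<noteq> 0 \<longrightarrow> a \<le> x \<and> x \<le> b)"
proof -
  have "compact (tsupp f) \<longleftrightarrow> (\<exists>a b. \<forall>x. f x \<noteq> 0 \<longrightarrow> a \<le> x \<and> x \<le> b)"
  proof
    assume "compact (tsupp f)"
    then have "bounded (tsupp f)" by (rule compact_imp_bounded)
    then obtain c where c: "\<forall>x\<in>tsupp f. \<bar>x\<bar> \<le> c" by (auto simp: bounded_iff)
    show "\<exists>a b. \<forall>x. f x \<noteq> 0 \<longrightarrow> a \<le> x \<and> x \<le> b"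
    proof (intro exI allI impI)
      fix x assume "f x \<noteq> 0"
      then have "x \<in> tsupp f" using tsupp_zero by blast
      then show "-c \<le> x \<and> x \<le> c" using c by (auto simp: abs_le_iff)
    qed
  next
    assume "\<exists>a b. \<forall>x. f x \<noteq> 0 \<longrightarrow> a \<le> x \<and> x \<le> b"
    then obtain a b where "\<forall>x. f x \<noteq> 0 \<longrightarrow> a \<le> x \<and> x \<le> b" by blast
    then have "tsupp f \<subseteq> {a..b}" by (intro tsupp_subset) auto
    moreover have "closed (tsupp f)" by (simp add: tsupp_def)
    ultimately show "compact (tsupp f)"
      by (metis bounded_closed_interval bounded_subset compact_eq_bounded_closed)
  qed
  then show ?thesis by (simp add: test_fun_def smooth_fun_iff)
qed

lemma test_fun_support: "test_fun f \<Longrightarrow> \<exists>a b. \<forall>x. f x \<noteq> 0 \<longrightarrow> a \<le> x \<and> x \<le> b"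
  unfolding test_fun_iff by blast

lemma test_fun_zero_above: "test_fun f \<Longrightarrow> \<exists>c. \<forall>x>c. f x = 0"
  using test_fun_support[of f] by (meson leD)

lemma tsupp_subset_Icc: "(\<And>x. f x \<noteq> 0 \<Longrightarrow> a \<le> x \<and> x \<le> b) \<Longrightarrow> tsupp f \<subseteq> {a..b}"
  by (rule tsupp_subset) auto

lemma test_fun_diff_upto: "test_fun f \<Longrightarrow> diff_upto k f"
  by (simp add: test_fun_iff)

lemma test_fun_DERIV: "test_fun f \<Longrightarrow> (f has_real_derivative deriv f x) (at x)"
  using test_fun_diff_upto diff_upto_DERIV by blast

lemma test_fun_continuous: "test_fun f \<Longrightarrow> continuous_on S f"
  by (intro continuous_at_imp_continuous_on ballI DERIV_isCont[OF test_fun_DERIV])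

lemma test_fun_add: "test_fun f \<Longrightarrow> test_fun g \<Longrightarrow> test_fun (\<lambda>x. f x + g x)"
proof -
  assume f: "test_fun f" and g: "test_fun g"
  obtain a b where ab: "\<And>x. f x \<noteq> 0 \<Longrightarrow> a \<le> x \<and> x \<le> b" using test_fun_support[OF f] by blast
  obtain a' b' where ab': "\<And>x. g x \<noteq> 0 \<Longrightarrow> a' \<le> x \<and> x \<le> b'" using test_fun_support[OF g] by blast
  have "\<forall>x. f x + g x \<noteq> 0 \<longrightarrow> min a a' \<le> x \<and> x \<le> max b b'"
  proof (intro allI impI)
    fix x assume "f x + g x \<noteq> 0"
    then have "f x \<noteq> 0 \<or> g x \<noteq> 0" by auto
    then show "min a a' \<le> x \<and> x \<le> max b b'" using ab[of x] ab'[of x] by auto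
  qed
  then show ?thesis using f g by (auto simp: test_fun_iff intro!: diff_upto_add)
qed

lemma test_fun_mult: "(\<And>k. diff_upto k f) \<Longrightarrow> test_fun g \<Longrightarrow> test_fun (\<lambda>x. f x * g x)"
  unfolding test_fun_iff mult_eq_0_iff by (blast intro: diff_upto_mult)

lemma test_fun_mult': "test_fun f \<Longrightarrow> (\<And>k. diff_upto k g) \<Longrightarrow> test_fun (\<lambda>x. f x * g x)"
  using test_fun_mult[of g f] by (simp add: mult.commute)

lemma test_fun_cmult: "test_fun g \<Longrightarrow> test_fun (\<lambda>x. c * g x)"
  by (rule test_fun_mult) (rule diff_upto_const)

lemma test_fun_diff: "test_fun f \<Longrightarrow> test_fun g \<Longrightarrow> test_fun (\<lambda>x. f x - g x)"
  using test_fun_add[of f "\<lambda>x. (-1) * g x"] test_fun_cmult[of g "-1"] by simp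

lemma test_fun_shift: "test_fun f \<Longrightarrow> test_fun (\<lambda>y. f (x + y))"
proof -
  assume f: "test_fun f"
  obtain a b where ab: "\<And>x. f x \<noteq> 0 \<Longrightarrow> a \<le> x \<and> x \<le> b" using test_fun_support[OF f] by blast
  have "\<forall>y. f (x + y) \<noteq> 0 \<longrightarrow> a - x \<le> y \<and> y \<le> b - x"
    using ab[of "x + _"] by force
  moreover have "diff_upto k (\<lambda>y. f (x + y))" for k
    using diff_upto_affine[OF test_fun_diff_upto[OF f], of k 1 x] by (simp add: add.commute)
  ultimately show ?thesis by (auto simp: test_fun_iff)
qed

lemma test_fun_deriv: "test_fun f \<Longrightarrow> test_fun (deriv f)"
proof -
  assume f: "test_fun f"
  obtain a b where ab: "\<And>x. f x \<noteq> 0 \<Longrightarrow> a \<le> x \<and> x \<le> b" using test_fun_support[OF f] by blast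
  have "deriv f x = 0" if "x \<notin> {a..b}" for x
  proof -
    have "((\<lambda>x. 0) has_real_derivative 0) (at x)" by simp
    then have "(f has_real_derivative 0) (at x)"
      by (rule has_field_derivative_transform_within_open[of _ _ _ "- {a..b}"])
         (use that ab in force)+
    then show ?thesis by (rule DERIV_imp_deriv)
  qed
  then have "\<forall>x. deriv f x \<noteq> 0 \<longrightarrow> a \<le> x \<and> x \<le> b" by auto
  moreover have "diff_upto k (deriv f)" for k
    using test_fun_diff_upto[OF f, of "Suc k"] by simp
  ultimately show ?thesis by (auto simp: test_fun_iff)
qed

lemma test_fun_bounded:
  assumes "test_fun f"
  shows "\<exists>M\<ge>0. \<forall>x. \<bar>f x\<bar> \<le> M"
proof -
  obtain a b where ab: "\<And>x. f x \<noteq> 0 \<Longrightarrow> a \<le> x \<and> x \<le> b" using test_fun_support[OF assms] by blast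
  have "compact (f ` {a..b})"
    using test_fun_continuous[OF assms] by (intro compact_continuous_image) auto
  then obtain M where M: "\<forall>y\<in>f ` {a..b}. \<bar>y\<bar> \<le> M"
    using compact_imp_bounded bounded_iff[of "f ` {a..b}"] by (metis real_norm_def)
  have "\<bar>f x\<bar> \<le> max M 0" for x
    using M ab[of x] by (cases "f x = 0") (auto simp: le_max_iff_disj)
  then show ?thesis by (intro exI[of _ "max M 0"]) auto
qed

lemma test_fun_le_Sup: "test_fun f \<Longrightarrow> \<bar>f x\<bar> \<le> Sup (range (\<lambda>x. \<bar>f x\<bar>))"
  by (rule cSup_upper) (use test_fun_bounded[of f] in \<open>auto simp: bdd_above_def\<close>)

text \<open>A rising ramp on [\<alpha> - 1, \<alpha>] times a falling ramp on
  [\<beta>, \<beta> + 1]. For \<beta> < \<alpha> the requirement is empty, so callers need not order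
  their bounds.\<close>

lemma cutoff_exists:
  "\<exists>w. test_fun w \<and> (\<forall>x. \<alpha> \<le> x \<longrightarrow> x \<le> \<beta> \<longrightarrow> w x = 1)"
proof -
  define w where "w x = smooth_step (1 * x + (1 - \<alpha>)) * smooth_step ((-1) * x + (\<beta> + 1))" for x
  have "diff_upto k w" for k
    unfolding w_def[abs_def] by (intro diff_upto_mult diff_upto_affine diff_upto_smooth_step)
  moreover have "w x \<noteq> 0 \<longrightarrow> \<alpha> - 1 \<le> x \<and> x \<le> \<beta> + 1" for x
    using smooth_step_0[of "1 * x + (1 - \<alpha>)"] smooth_step_0[of "(-1) * x + (\<beta> + 1)"]
    unfolding w_def mult_eq_0_iff by linarith
  ultimately have "test_fun w" by (auto simp: test_fun_iff)
  moreover have "w x = 1" if "\<alpha> \<le> x" "x \<le> \<beta>" for x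
    using that by (simp add: w_def smooth_step_1)
  ultimately show ?thesis by blast
qed

section \<open>Distributions of order zero and their convolution\<close>

text \<open>By Riesz representation these are the real functionals given locally by signed measures.
  \<open>is_distr\<close> follows with no derivatives in the seminorm.\<close>

definition radon :: "distr \<Rightarrow> bool" where
  "radon T \<longleftrightarrow>
     (\<forall>\<phi> \<psi>. test_fun \<phi> \<longrightarrow> test_fun \<psi> \<longrightarrow> T (\<lambda>x. \<phi> x + \<psi> x) = T \<phi> + T \<psi>) \<and>
     (\<forall>c \<phi>. test_fun \<phi> \<longrightarrow> T (\<lambda>x. c * \<phi> x) = c * T \<phi>) \<and> distr_order_zero T"

definition radon_plus :: "distr \<Rightarrow> bool" where
  "radon_plus T \<longleftrightarrow> radon T \<and> (\<exists>a. supp_ge T a)"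

lemma radon_add: "radon T \<Longrightarrow> test_fun \<phi> \<Longrightarrow> test_fun \<psi> \<Longrightarrow> T (\<lambda>x. \<phi> x + \<psi> x) = T \<phi> + T \<psi>"
  and radon_cmult: "radon T \<Longrightarrow> test_fun \<phi> \<Longrightarrow> T (\<lambda>x. c * \<phi> x) = c * T \<phi>"
  by (auto simp: radon_def)

lemma radon_diff:
  "radon T \<Longrightarrow> test_fun \<phi> \<Longrightarrow> test_fun \<psi> \<Longrightarrow> T (\<lambda>x. \<phi> x - \<psi> x) = T \<phi> - T \<psi>"
  using radon_add[of T \<phi> "\<lambda>x. (-1) * \<psi> x"] radon_cmult[of T \<psi> "-1"] test_fun_cmult[of \<psi> "-1"]
  by simp

text \<open>An arbitrary bound M replaces the supremum and the constant is made nonnegative, so that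
  estimates of nested functionals can be multiplied.\<close>

lemma radon_bound:
  assumes "radon T"
  shows "\<exists>C\<ge>0. \<forall>\<phi> M. test_fun \<phi> \<longrightarrow> (\<forall>x. \<phi> x \<noteq> 0 \<longrightarrow> a \<le> x \<and> x \<le> b) \<longrightarrow> (\<forall>x. \<bar>\<phi> x\<bar> \<le> M) \<longrightarrow> \<bar>T \<phi>\<bar> \<le> C * M"
proof -
  obtain C where C: "\<And>\<phi>. test_fun \<phi> \<Longrightarrow> tsupp \<phi> \<subseteq> {a..b} \<Longrightarrow> \<bar>T \<phi>\<bar> \<le> C * Sup (range (\<lambda>x. \<bar>\<phi> x\<bar>))"
    using assms unfolding radon_def distr_order_zero_def by blast
  have "\<bar>T \<phi>\<bar> \<le> \<bar>C\<bar> * M"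
    if \<phi>: "test_fun \<phi>" "\<And>x. \<phi> x \<noteq> 0 \<Longrightarrow> a \<le> x \<and> x \<le> b" "\<And>x. \<bar>\<phi> x\<bar> \<le> M" for \<phi> M
  proof -
    have S: "Sup (range (\<lambda>x. \<bar>\<phi> x\<bar>)) \<le> M" by (rule cSup_least) (use \<phi> in auto)
    have S0: "0 \<le> Sup (range (\<lambda>x. \<bar>\<phi> x\<bar>))"
      using test_fun_le_Sup[OF \<phi>(1), of 0] by linarith
    have "\<bar>T \<phi>\<bar> \<le> C * Sup (range (\<lambda>x. \<bar>\<phi> x\<bar>))" using C \<phi> tsupp_subset_Icc by blast
    also have "\<dots> \<le> \<bar>C\<bar> * Sup (range (\<lambda>x. \<bar>\<phi> x\<bar>))" using S0 by (intro mult_right_mono) auto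
    also have "\<dots> \<le> \<bar>C\<bar> * M" using S by (intro mult_left_mono) auto
    finally show ?thesis .
  qed
  then show ?thesis by (intro exI[of _ "\<bar>C\<bar>"]) auto
qed

lemma radonI:
  assumes "\<And>\<phi> \<psi>. test_fun \<phi> \<Longrightarrow> test_fun \<psi> \<Longrightarrow> T (\<lambda>x. \<phi> x + \<psi> x) = T \<phi> + T \<psi>"
    and "\<And>c \<phi>. test_fun \<phi> \<Longrightarrow> T (\<lambda>x. c * \<phi> x) = c * T \<phi>"
    and "\<And>a b. \<exists>C. \<forall>\<phi> M. test_fun \<phi> \<longrightarrow> (\<forall>x. \<phi> x \<noteq> 0 \<longrightarrow> a \<le> x \<and> x \<le> b) \<longrightarrow> (\<forall>x. \<bar>\<phi> x\<bar> \<le> M) \<longrightarrow>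
        \<bar>T \<phi>\<bar> \<le> C * M"
  shows "radon T"
proof -
  have "\<exists>C. \<forall>\<phi>. test_fun \<phi> \<longrightarrow> tsupp \<phi> \<subseteq> {a..b} \<longrightarrow> \<bar>T \<phi>\<bar> \<le> C * Sup (range (\<lambda>x. \<bar>\<phi> x\<bar>))" for a b
  proof -
    obtain C where C: "\<forall>\<phi> M. test_fun \<phi> \<longrightarrow> (\<forall>x. \<phi> x \<noteq> 0 \<longrightarrow> a \<le> x \<and> x \<le> b) \<longrightarrow> (\<forall>x. \<bar>\<phi> x\<bar> \<le> M) \<longrightarrow>
        \<bar>T \<phi>\<bar> \<le> C * M"
      using assms(3) by blast
    have "\<bar>T \<phi>\<bar> \<le> C * Sup (range (\<lambda>x. \<bar>\<phi> x\<bar>))" if "test_fun \<phi>" "tsupp \<phi> \<subseteq> {a..b}" for \<phi>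
    proof -
      have "\<forall>x. \<phi> x \<noteq> 0 \<longrightarrow> a \<le> x \<and> x \<le> b"
        using that(2) tsupp_zero[of _ \<phi>] by (meson atLeastAtMost_iff subsetD)
      then show ?thesis using C that(1) test_fun_le_Sup[OF that(1)] by blast
    qed
    then show ?thesis by blast
  qed
  then show ?thesis using assms(1,2) by (auto simp: radon_def distr_order_zero_def)
qed

lemma radon_is_distr: "radon T \<Longrightarrow> is_distr T"
  unfolding is_distr_def
proof (intro conjI allI)
  fix a b assume T: "radon T"
  then obtain C where "\<forall>\<phi>. test_fun \<phi> \<longrightarrow> tsupp \<phi> \<subseteq> {a..b} \<longrightarrow> \<bar>T \<phi>\<bar> \<le> C * Sup (range (\<lambda>x. \<bar>\<phi> x\<bar>))"
    unfolding radon_def distr_order_zero_def by blast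
  then show "\<exists>C k. \<forall>\<phi>. test_fun \<phi> \<longrightarrow> tsupp \<phi> \<subseteq> {a..b} \<longrightarrow>
         \<bar>T \<phi>\<bar> \<le> C * (\<Sum>j\<le>(k::nat). Sup (range (\<lambda>x. \<bar>(deriv ^^ j) \<phi> x\<bar>)))"
    by (intro exI[of _ C] exI[of _ 0]) simp
qed (auto simp: radon_def)

lemma radon_plus_distr_plus: "radon_plus T \<Longrightarrow> distr_plus T"
  by (auto simp: radon_plus_def distr_plus_def radon_is_distr)

text \<open>The strict gap d < a matters: \<open>supp_ge\<close> speaks of closed supports, and a
  function vanishing only to the right of a may still have a in its support. This gap is the purpose
  of the margins of 1 in the cutoffs of \<open>conv\<close>.\<close>

lemma supp_geD:
  assumes "supp_ge T a" "test_fun \<phi>" "d < a" "\<And>x. x > d \<Longrightarrow> \<phi> x = 0"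
  shows "T \<phi> = 0"
proof -
  have "tsupp \<phi> \<subseteq> {..d}" using assms by (intro tsupp_subset) auto
  then have "tsupp \<phi> \<inter> {a..} = {}" using assms(3) by auto
  then show ?thesis using assms by (auto simp: supp_ge_def)
qed

lemma supp_ge_eq:
  assumes "radon T" "supp_ge T a" "test_fun \<phi>" "test_fun \<psi>" "d < a" "\<And>x. x > d \<Longrightarrow> \<phi> x = \<psi> x"
  shows "T \<phi> = T \<psi>"
  using supp_geD[OF assms(2) test_fun_diff[OF assms(3,4)] assms(5)] assms(6) radon_diff[OF assms(1,3,4)]
  by simp

text \<open>The mean value inequality, applied twice, with a bound on the second derivative.
  Uniformity in z is the point: z will be x + y with y the variable of a functional.\<close>

lemma test_fun_quadratic_remainder:
  assumes "test_fun \<phi>"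
  shows "\<exists>M\<ge>0. \<forall>z h. \<bar>\<phi> (z + h) - \<phi> z - h * deriv \<phi> z\<bar> \<le> M * h\<^sup>2"
proof -
  note t1 = test_fun_deriv[OF assms]
  obtain M where M: "M \<ge> 0" "\<And>x. \<bar>deriv (deriv \<phi>) x\<bar> \<le> M"
    using test_fun_bounded[OF test_fun_deriv[OF t1]] by blast
  have L: "\<bar>deriv \<phi> u - deriv \<phi> v\<bar> \<le> M * \<bar>u - v\<bar>" for u v
    using field_differentiable_bound[of UNIV "deriv \<phi>"
        "deriv (deriv \<phi>)" M u v] M(2) test_fun_DERIV[OF t1]
    by auto
  have "\<bar>\<phi> (z + h) - \<phi> z - h * deriv \<phi> z\<bar> \<le> M * h\<^sup>2" for z h
  proof -
    \<comment> \<open>Its derivative is a difference of values of \<open>deriv \<phi>\<close>, hence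
      at most M times the modulus of h on the interval used below.\<close>
    define f where "f t = \<phi> (z + t) - t * deriv \<phi> z" for t
    have d: "(f has_real_derivative deriv \<phi> (z + t) - deriv \<phi> z) (at t within S)" for t S
    proof -
      have "((\<lambda>t. \<phi> (z + t)) has_real_derivative deriv \<phi> (z + t)) (at t)"
        using test_fun_DERIV[OF assms, of "z + t"] by (simp add: DERIV_shift add.commute)
      from DERIV_diff[OF this DERIV_cmult_right[OF DERIV_ident, of "deriv \<phi> z"]]
      have "(f has_real_derivative deriv \<phi> (z + t) - deriv \<phi> z) (at t)"
        by (simp add: f_def[abs_def])
      then show ?thesis by (rule has_field_derivative_at_within)
    qed
    have "norm (f h - f 0) \<le> (M * \<bar>h\<bar>) * norm (h - 0)"
    proof (rule field_differentiable_bound[where S = "{-\<bar>h\<bar>..\<bar>h\<bar>}"])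
      fix t assume "t \<in> {-\<bar>h\<bar>..\<bar>h\<bar>}"
      then have "M * \<bar>t\<bar> \<le> M * \<bar>h\<bar>" using M(1) by (intro mult_left_mono) auto
      then show "norm (deriv \<phi> (z + t) - deriv \<phi> z) \<le> M * \<bar>h\<bar>"
        using L[of "z + t" z] by simp
    qed (auto intro: d)
    then show ?thesis by (simp add: f_def power2_eq_square algebra_simps flip: abs_mult)
  qed
  then show ?thesis using M(1) by blast
qed

lemma test_fun_cutoff_shift: "test_fun w \<Longrightarrow> test_fun \<phi> \<Longrightarrow> test_fun (\<lambda>y. w y * \<phi> (x + y))"
  by (intro test_fun_mult test_fun_diff_upto test_fun_shift)

text \<open>Order zero makes the second order Taylor remainder of the test function small after
  applying the functional, so differentiation passes through it.\<close>

lemma radon_shift_DERIV: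
  assumes T: "radon T" and w: "test_fun w" and \<phi>: "test_fun \<phi>"
  shows "((\<lambda>x. T (\<lambda>y. w y * \<phi> (x + y))) has_real_derivative T (\<lambda>y. w y * deriv \<phi> (x + y))) (at x)"
proof -
  obtain a b where ab: "\<And>x. w x \<noteq> 0 \<Longrightarrow> a \<le> x \<and> x \<le> b" using test_fun_support[OF w] by blast
  obtain C where C: "C \<ge> 0"
    "\<And>\<phi> M. test_fun \<phi> \<Longrightarrow> (\<And>x. \<phi> x \<noteq> 0 \<Longrightarrow> a \<le> x \<and> x \<le> b) \<Longrightarrow> (\<And>x. \<bar>\<phi> x\<bar> \<le> M) \<Longrightarrow> \<bar>T \<phi>\<bar> \<le> C * M"
    using radon_bound[OF T, of a b] by blast
  obtain W where W: "W \<ge> 0" "\<And>x. \<bar>w x\<bar> \<le> W" using test_fun_bounded[OF w] by blast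
  obtain M where M: "M \<ge> 0" "\<And>z h. \<bar>\<phi> (z + h) - \<phi> z - h * deriv \<phi> z\<bar> \<le> M * h\<^sup>2"
    using test_fun_quadratic_remainder[OF \<phi>] by blast
  show ?thesis
  proof (rule DERIV_quadratic_remainder[where K = "C * (W * M)"])
    fix h
    let ?F = "\<lambda>\<phi> x. (\<lambda>y. w y * \<phi> (x + y))"
    have t: "test_fun (?F \<phi> (x + h))" "test_fun (?F \<phi> x)" "test_fun (?F (deriv \<phi>) x)"
      by (intro test_fun_cutoff_shift w \<phi> test_fun_deriv)+
    \<comment> \<open>The factor w confines this remainder to an interval independent of h, so a
      single constant C of T serves for all h.\<close>
    let ?R = "\<lambda>y. (?F \<phi> (x + h) y - ?F \<phi> x y) - h * ?F (deriv \<phi>) x y"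
    have tR: "test_fun ?R" by (intro test_fun_diff test_fun_cmult t)
    have TR: "T ?R = T (?F \<phi> (x + h)) - T (?F \<phi> x) - h * T (?F (deriv \<phi>) x)"
      by (simp add: radon_diff[OF T] radon_cmult[OF T] t test_fun_diff test_fun_cmult)
    have R: "?R y = w y * (\<phi> ((x + y) + h) - \<phi> (x + y) - h * deriv \<phi> (x + y))" for y
      by (simp add: algebra_simps)
    have "\<bar>?R y\<bar> \<le> W * (M * h\<^sup>2)" for y
      unfolding R abs_mult by (intro mult_mono W M) auto
    moreover have "a \<le> y \<and> y \<le> b" if "?R y \<noteq> 0" for y
      using that ab[of y] unfolding R by auto
    ultimately have "\<bar>T ?R\<bar> \<le> C * (W * (M * h\<^sup>2))" using C(2) tR by blast
    then show "\<bar>T (?F \<phi> (x + h)) - T (?F \<phi> x) - h * T (?F (deriv \<phi>) x)\<bar> \<le> C * (W * M) * h\<^sup>2"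
      unfolding TR by (simp add: mult.assoc)
  qed
qed

text \<open>The derivative has the same form with \<open>deriv \<phi>\<close> for
  \<open>\<phi>\<close>, which closes the induction.\<close>

lemma diff_upto_radon_shift:
  assumes T: "radon T" and w: "test_fun w"
  shows "test_fun \<phi> \<Longrightarrow> diff_upto k (\<lambda>x. T (\<lambda>y. w y * \<phi> (x + y)))"
proof (induction k arbitrary: \<phi>)
  case 0
  then show ?case using radon_shift_DERIV[OF T w] by (auto simp: real_differentiable_def)
next
  case (Suc k)
  show ?case
    by (rule diff_upto_SucI[OF radon_shift_DERIV[OF T w Suc.prems]]) (intro Suc.IH test_fun_deriv Suc.prems)
qed

section \<open>Independence of the cutoffs, and the computation of \<open>conv\<close>\<close>

lemma test_fun_radon_shift:
  "radon T \<Longrightarrow> test_fun w1 \<Longrightarrow> test_fun w2 \<Longrightarrow> test_fun \<phi> \<Longrightarrow>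
      test_fun (\<lambda>x. w1 x * T (\<lambda>y. w2 y * \<phi> (x + y)))"
  by (rule test_fun_mult') (auto intro: diff_upto_radon_shift)

text \<open>S sees only x > a - 1 and T only y > b - 1. Where in addition x + y \<le> c, both inner
  cutoffs are 1 because y < c - a + 1. For x > c - b + 1 the sum x + y always exceeds c, so the
  inner value is 0 and the outer cutoff is irrelevant.\<close>

lemma conv_independent_aux:
  assumes S: "radon S" "supp_ge S a" and T: "radon T" "supp_ge T b" and \<phi>: "test_fun \<phi>"
      "\<And>x. x > c \<Longrightarrow> \<phi> x = 0"
    and w: "test_fun w1" "test_fun w2" "\<And>x. a - 1 \<le> x \<Longrightarrow> x \<le> c - b + 1 \<Longrightarrow> w1 x = 1"
        "\<And>y. b - 1 \<le> y \<Longrightarrow> y \<le> c - a + 1 \<Longrightarrow> w2 y = 1"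
    and v: "test_fun v1" "test_fun v2" "\<And>x. a - 1 \<le> x \<Longrightarrow> x \<le> c - b + 1 \<Longrightarrow> v1 x = 1"
        "\<And>y. b - 1 \<le> y \<Longrightarrow> y \<le> c - a + 1 \<Longrightarrow> v2 y = 1"
  shows "S (\<lambda>x. w1 x * T (\<lambda>y. w2 y * \<phi> (x + y))) = S (\<lambda>x. v1 x * T (\<lambda>y. v2 y * \<phi> (x + y)))"
proof (rule supp_ge_eq[OF S(1,2), where d = "a - 1"])
  show "test_fun (\<lambda>x. w1 x * T (\<lambda>y. w2 y * \<phi> (x + y)))"
      "test_fun (\<lambda>x. v1 x * T (\<lambda>y. v2 y * \<phi> (x + y)))"
    by (intro test_fun_radon_shift T w v \<phi>)+
  fix x assume x: "x > a - 1"
  have eq: "T (\<lambda>y. w2 y * \<phi> (x + y)) = T (\<lambda>y. v2 y * \<phi> (x + y))"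
  proof (rule supp_ge_eq[OF T(1,2), where d = "b - 1"])
    fix y assume y: "y > b - 1"
    show "w2 y * \<phi> (x + y) = v2 y * \<phi> (x + y)"
    proof (cases "x + y > c")
      case False
      then have "w2 y = 1" "v2 y = 1" using x y by (auto intro!: w v)
      then show ?thesis by simp
    qed (simp add: \<phi>)
  qed (auto intro: test_fun_cutoff_shift w v \<phi>)
  show "w1 x * T (\<lambda>y. w2 y * \<phi> (x + y)) = v1 x * T (\<lambda>y. v2 y * \<phi> (x + y))"
  proof (cases "x \<le> c - b + 1")
    case True
    then have "w1 x = 1" "v1 x = 1" using x by (auto intro!: w v)
    then show ?thesis using eq by simp
  next
    case False
    have "T (\<lambda>y. v2 y * \<phi> (x + y)) = 0"
      by (rule supp_geD[OF T(2), where d =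
          "b - 1"]) (use False in \<open>auto intro: test_fun_cutoff_shift v \<phi>\<close>)
    then show ?thesis using eq by simp
  qed
qed simp

text \<open>Passing to the larger of the two lower support bounds and the smaller upper bound of the
  test function makes both cutoffs admissible for the same triple.\<close>

lemma conv_independent:
  assumes S: "radon S" "supp_ge S a" "supp_ge S a'" and T: "radon T" "supp_ge T b" "supp_ge T b'"
    and \<phi>: "test_fun \<phi>" "\<And>x. x > c \<Longrightarrow> \<phi> x = 0" "\<And>x. x > c' \<Longrightarrow> \<phi> x = 0"
    and w: "test_fun w1" "test_fun w2" "\<And>x. a - 1 \<le> x \<Longrightarrow> x \<le> c - b + 1 \<Longrightarrow> w1 x = 1"
        "\<And>y. b - 1 \<le> y \<Longrightarrow> y \<le> c - a + 1 \<Longrightarrow> w2 y = 1"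
    and v: "test_fun v1" "test_fun v2" "\<And>x. a' - 1 \<le> x \<Longrightarrow> x \<le> c' - b' + 1 \<Longrightarrow> v1 x = 1"
        "\<And>y. b' - 1 \<le> y \<Longrightarrow> y \<le> c' - a' + 1 \<Longrightarrow> v2 y = 1"
  shows "S (\<lambda>x. w1 x * T (\<lambda>y. w2 y * \<phi> (x + y))) = S (\<lambda>x. v1 x * T (\<lambda>y. v2 y * \<phi> (x + y)))"
proof (rule conv_independent_aux[where a = "max a a'" and b = "max b b'" and c = "min c c'"])
  show "supp_ge S (max a a')" using S by (simp add: max_def)
  show "supp_ge T (max b b')" using T by (simp add: max_def)
  show "\<phi> x = 0" if "x > min c c'" for x using that \<phi>(2,3)[of x] by linarith
qed (auto intro!: S T \<phi> w v)

text \<open>The given cutoffs witness that the choice in \<open>conv\<close> is satisfiable. The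
  chosen tuple is then admissible as well, and \<open>conv_independent\<close> equates the two
  values.\<close>

lemma conv_value:
  assumes S: "radon S" "supp_ge S a" and T: "radon T" "supp_ge T b" and \<phi>: "test_fun \<phi>"
      "\<And>x. x > c \<Longrightarrow> \<phi> x = 0"
    and w: "test_fun w1" "test_fun w2" "\<And>x. a - 1 \<le> x \<Longrightarrow> x \<le> c - b + 1 \<Longrightarrow> w1 x = 1"
        "\<And>y. b - 1 \<le> y \<Longrightarrow> y \<le> c - a + 1 \<Longrightarrow> w2 y = 1"
  shows "conv S T \<phi> = S (\<lambda>x. w1 x * T (\<lambda>y. w2 y * \<phi> (x + y)))"
proof -
  define P where "P = (\<lambda>(a, b, c, v1, v2).
          supp_ge S a \<and> supp_ge T b \<and> tsupp \<phi> \<subseteq> {..c} \<and>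
          test_fun v1 \<and> test_fun v2 \<and>
          (\<forall>x\<in>{a-1..c-b+1}. v1 x = 1) \<and> (\<forall>y\<in>{b-1..c-a+1}. v2 y = 1))"
  have "tsupp \<phi> \<subseteq> {..c}" by (rule tsupp_subset) (use \<phi> in auto)
  then have "P (a, b, c, w1, w2)" using assms by (auto simp: P_def)
  then have P: "P (SOME p. P p)" by (rule someI)
  obtain a' b' c' v1 v2 where v: "(SOME p. P p) = (a', b', c', v1, v2)" by (metis surj_pair)
  have P': "supp_ge S a' \<and> supp_ge T b' \<and> tsupp \<phi> \<subseteq> {..c'} \<and> test_fun v1 \<and> test_fun v2 \<and>
      (\<forall>x\<in>{a'-1..c'-b'+1}. v1 x = 1) \<and> (\<forall>y\<in>{b'-1..c'-a'+1}. v2 y = 1)"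
    using P unfolding v by (simp add: P_def)
  have "conv S T \<phi> = (let (a, b, c, v1, v2) =
      (SOME p. P p) in S (\<lambda>x. v1 x * T (\<lambda>y. v2 y * \<phi> (x + y))))"
    unfolding conv_def P_def ..
  also have "\<dots> = S (\<lambda>x. v1 x * T (\<lambda>y. v2 y * \<phi> (x + y)))"
    unfolding v by simp
  also have "\<dots> = S (\<lambda>x. w1 x * T (\<lambda>y. w2 y * \<phi> (x + y)))"
  proof (rule conv_independent[where a = a' and b = b' and c = c' and a' = a and b' = b and c' = c])
    have "tsupp \<phi> \<subseteq> {..c'}" using P' by auto
    then show "\<phi> x = 0" if "x > c'" for x using that by (meson atMost_iff leD subsetD tsupp_zero)
  qed (use P' in \<open>auto intro!: S T \<phi> w\<close>)
  finally show ?thesis .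
qed

text \<open>Functionals agreeing on test functions may differ elsewhere, so \<open>conv\<close> of
  each is a different term with its own choice. Since \<open>supp_ge\<close> and order zero look at
  test functions only, one pair of cutoffs evaluates both.\<close>

lemma conv_cong_right:
  assumes eq: "\<And>\<phi>. test_fun \<phi> \<Longrightarrow> T \<phi> = T' \<phi>"
    and "radon_plus S" "radon_plus T" "test_fun \<phi>"
  shows "conv S T \<phi> = conv S T' \<phi>"
proof -
  obtain a b where S: "radon S" "supp_ge S a" and T: "radon T" "supp_ge T b"
    using assms by (auto simp: radon_plus_def)
  have T': "radon T'" "supp_ge T' b"
    using T test_fun_add test_fun_cmult
    by (auto simp: radon_def distr_order_zero_def supp_ge_def eq[symmetric])
  obtain c where c: "\<And>x. x > c \<Longrightarrow> \<phi> x = 0" using test_fun_zero_above[OF assms(4)] by blast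
  obtain w1 where w1: "test_fun w1" "\<And>x. a - 1 \<le> x \<Longrightarrow> x \<le> c - b + 1 \<Longrightarrow> w1 x = 1"
    using cutoff_exists by blast
  obtain w2 where w2: "test_fun w2" "\<And>x. b - 1 \<le> x \<Longrightarrow> x \<le> c - a + 1 \<Longrightarrow> w2 x = 1"
    using cutoff_exists by blast
  show ?thesis
    using conv_value[OF S T assms(4) c w1(1) w2(1) w1(2) w2(2)]
      conv_value[OF S T' assms(4) c w1(1) w2(1) w1(2) w2(2)]
      eq[OF test_fun_cutoff_shift[OF w2(1) assms(4)]]
    by simp
qed

text \<open>The cutoffs depend on c alone. One pair therefore serves all test functions vanishing
  above c, as needed to compare several of them at once.\<close>

lemma conv_expansion:
  assumes S: "radon S" "supp_ge S a" and T: "radon T" "supp_ge T b"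
  shows "\<exists>w1 w2. test_fun w1 \<and> test_fun w2 \<and>
    (\<forall>\<phi>. test_fun \<phi> \<longrightarrow> (\<forall>x>c. \<phi> x = 0) \<longrightarrow> conv S T \<phi> = S (\<lambda>x. w1 x * T (\<lambda>y. w2 y * \<phi> (x + y))))"
proof -
  obtain w1 where w1: "test_fun w1" "\<And>x. a - 1 \<le> x \<Longrightarrow> x \<le> c - b + 1 \<Longrightarrow> w1 x = 1"
    using cutoff_exists by blast
  obtain w2 where w2: "test_fun w2" "\<And>x. b - 1 \<le> x \<Longrightarrow> x \<le> c - a + 1 \<Longrightarrow> w2 x = 1"
    using cutoff_exists by blast
  have "conv S T \<phi> = S (\<lambda>x. w1 x * T (\<lambda>y. w2 y * \<phi> (x + y)))"
    if "test_fun \<phi>" "\<forall>x>c. \<phi> x = 0" for \<phi>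
    by (rule conv_value[OF S T that(1) _ w1(1) w2(1) w1(2) w2(2)]) (use that in auto)
  then show ?thesis by (intro exI[of _ w1] exI[of _ w2]) (simp add: w1 w2)
qed

lemma radon_plus_conv:
  assumes "radon_plus S" "radon_plus T"
  shows "radon_plus (conv S T)"
proof -
  obtain a b where S: "radon S" "supp_ge S a" and T: "radon T" "supp_ge T b"
    using assms by (auto simp: radon_plus_def)
  note ex = conv_expansion[OF S T]
  have "radon (conv S T)"
  proof (rule radonI)
    fix \<phi> \<psi> assume t: "test_fun \<phi>" "test_fun \<psi>"
    obtain c where c: "\<And>x. x > c \<Longrightarrow> \<phi> x = 0" using test_fun_zero_above[OF t(1)] by blast
    obtain c' where c': "\<And>x. x > c' \<Longrightarrow> \<psi> x = 0" using test_fun_zero_above[OF t(2)] by blast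
    obtain w1 w2 where w: "test_fun w1" "test_fun w2" and cv:
      "\<forall>\<phi>. test_fun \<phi> \<longrightarrow> (\<forall>x>max c c'. \<phi> x = 0) \<longrightarrow>
          conv S T \<phi> = S (\<lambda>x. w1 x * T (\<lambda>y. w2 y * \<phi> (x + y)))"
      using ex[where c = "max c c'"] by (elim exE conjE) (rule that)
    have 1: "conv S T \<phi> = S (\<lambda>x. w1 x * T (\<lambda>y. w2 y * \<phi> (x + y)))"
      "conv S T \<psi> = S (\<lambda>x. w1 x * T (\<lambda>y. w2 y * \<psi> (x + y)))"
      "conv S T (\<lambda>x. \<phi> x + \<psi> x) = S (\<lambda>x. w1 x * T (\<lambda>y. w2 y * (\<phi> (x + y) + \<psi> (x + y))))"
      by (rule cv[rule_format]; use t c c' in \<open>auto intro: test_fun_add\<close>)+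
    have "T (\<lambda>y. w2 y * (\<phi> (x + y) + \<psi> (x + y))) = T (\<lambda>y. w2 y * \<phi> (x + y)) +
        T (\<lambda>y. w2 y * \<psi> (x + y))" for x
      using radon_add[OF T(1) test_fun_cutoff_shift[OF w(2) t(1)] test_fun_cutoff_shift[OF w(2) t(2)], of x x]
      by (simp add: distrib_left)
    then show "conv S T (\<lambda>x. \<phi> x + \<psi> x) = conv S T \<phi> + conv S T \<psi>"
      unfolding 1 using radon_add[OF S(1) test_fun_radon_shift[OF T(1) w t(1)] test_fun_radon_shift[OF T(1) w t(2)]]
      by (simp add: distrib_left)
  next
    fix k \<phi> assume t: "test_fun \<phi>"
    obtain c where c: "\<And>x. x > c \<Longrightarrow> \<phi> x = 0" using test_fun_zero_above[OF t] by blast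
    obtain w1 w2 where w: "test_fun w1" "test_fun w2" and cv:
      "\<forall>\<phi>. test_fun \<phi> \<longrightarrow> (\<forall>x>c. \<phi> x = 0) \<longrightarrow> conv S T \<phi> = S (\<lambda>x. w1 x * T (\<lambda>y. w2 y * \<phi> (x + y)))"
      using ex[where c = "c"] by (elim exE conjE) (rule that)
    have 1: "conv S T \<phi> = S (\<lambda>x. w1 x * T (\<lambda>y. w2 y * \<phi> (x + y)))"
      "conv S T (\<lambda>x. k * \<phi> x) = S (\<lambda>x. w1 x * T (\<lambda>y. w2 y * (k * \<phi> (x + y))))"
      by (rule cv[rule_format]; use t c in \<open>auto intro: test_fun_cmult\<close>)+
    show "conv S T (\<lambda>x. k * \<phi> x) = k * conv S T \<phi>"
      unfolding 1 using radon_cmult[OF T(1) test_fun_cutoff_shift[OF w(2) t], of k]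
        radon_cmult[OF S(1) test_fun_radon_shift[OF T(1) w t], of k]
      by (simp add: mult.left_commute)
  next
    fix \<alpha> c
    obtain w1 w2 where w: "test_fun w1" "test_fun w2" and cv:
      "\<forall>\<phi>. test_fun \<phi> \<longrightarrow> (\<forall>x>c. \<phi> x = 0) \<longrightarrow> conv S T \<phi> = S (\<lambda>x. w1 x * T (\<lambda>y. w2 y * \<phi> (x + y)))"
      using ex[where c = "c"] by (elim exE conjE) (rule that)
    obtain a1 b1 where s1: "\<And>x. w1 x \<noteq> 0 \<Longrightarrow> a1 \<le> x \<and> x \<le> b1" using test_fun_support[OF w(1)] by blast
    obtain a2 b2 where s2: "\<And>x. w2 x \<noteq> 0 \<Longrightarrow> a2 \<le> x \<and> x \<le> b2" using test_fun_support[OF w(2)] by blast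
    obtain W1 where W1: "W1 \<ge> 0" "\<And>x. \<bar>w1 x\<bar> \<le> W1" using test_fun_bounded[OF w(1)] by blast
    obtain W2 where W2: "W2 \<ge> 0" "\<And>x. \<bar>w2 x\<bar> \<le> W2" using test_fun_bounded[OF w(2)] by blast
    obtain C1 where C1: "C1 \<ge> 0"
      "\<And>\<phi> M. test_fun \<phi> \<Longrightarrow> (\<And>x. \<phi> x \<noteq> 0 \<Longrightarrow> a1 \<le> x \<and> x \<le> b1) \<Longrightarrow> (\<And>x. \<bar>\<phi> x\<bar> \<le> M) \<Longrightarrow> \<bar>S \<phi>\<bar> \<le> C1 * M"
      using radon_bound[OF S(1)] by blast
    obtain C2 where C2: "C2 \<ge> 0"
      "\<And>\<phi> M. test_fun \<phi> \<Longrightarrow> (\<And>x. \<phi> x \<noteq> 0 \<Longrightarrow> a2 \<le> x \<and> x \<le> b2) \<Longrightarrow> (\<And>x. \<bar>\<phi> x\<bar> \<le> M) \<Longrightarrow> \<bar>T \<phi>\<bar> \<le> C2 * M"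
      using radon_bound[OF T(1)] by blast
    show "\<exists>C. \<forall>\<phi> M. test_fun \<phi> \<longrightarrow> (\<forall>x. \<phi> x \<noteq> 0 \<longrightarrow> \<alpha> \<le> x \<and> x \<le> c) \<longrightarrow> (\<forall>x. \<bar>\<phi> x\<bar> \<le> M) \<longrightarrow>
        \<bar>conv S T \<phi>\<bar> \<le> C * M"
    \<comment> \<open>The inner functional is at most C2 * W2 * M, the outer cutoff multiplies this
      by W1, and the outer functional by C1. The supports of the cutoffs provide the compact
      intervals for both constants.\<close>
    proof (intro exI[of _ "C1 * (W1 * (C2 * W2))"] allI impI)
      fix \<phi> M assume t: "test_fun \<phi>" and s: "\<forall>x. \<phi> x \<noteq> 0 \<longrightarrow> \<alpha> \<le> x \<and> x \<le> c" and M: "\<forall>x. \<bar>\<phi> x\<bar> \<le> M"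
      have M0: "M \<ge> 0" using M[rule_format, of 0] by linarith
      have 1: "\<bar>T (\<lambda>y. w2 y * \<phi> (x + y))\<bar> \<le> C2 * (W2 * M)" for x
      proof (rule C2)
        show "test_fun (\<lambda>y. w2 y * \<phi> (x + y))" by (intro test_fun_cutoff_shift w t)
        show "\<bar>w2 y * \<phi> (x + y)\<bar> \<le> W2 * M" for y
          unfolding abs_mult using W2 M by (intro mult_mono) auto
      qed (use s2 in auto)
      have "\<bar>S (\<lambda>x. w1 x * T (\<lambda>y. w2 y * \<phi> (x + y)))\<bar> \<le> C1 * (W1 * (C2 * (W2 * M)))"
      proof (rule C1)
        show "test_fun (\<lambda>x. w1 x * T (\<lambda>y. w2 y * \<phi> (x + y)))" by (intro test_fun_radon_shift w t T)
        show "\<bar>w1 x * T (\<lambda>y. w2 y * \<phi> (x + y))\<bar> \<le> W1 * (C2 * (W2 * M))" for x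
          unfolding abs_mult using W1 1 by (intro mult_mono) auto
      qed (use s1 in auto)
      moreover have "\<phi> x = 0" if "x > c" for x using s that by (meson leD)
      ultimately show "\<bar>conv S T \<phi>\<bar> \<le> C1 * (W1 * (C2 * W2)) * M"
        using cv[rule_format, OF t] by (simp add: mult.assoc)
    qed
  qed
  \<comment> \<open>Not the sharp bound a + b: giving away 1 in each variable provides the strict
    gaps for \<open>supp_geD\<close>, since x > a - 1 and y > b - 1 give x + y > a + b - 2.\<close>
  moreover have "supp_ge (conv S T) (a + b - 2)"
    unfolding supp_ge_def
  proof (intro allI impI)
    fix \<phi> assume t: "test_fun \<phi>" and s: "tsupp \<phi> \<inter> {a + b - 2..} = {}"
    have \<phi>0: "\<phi> x = 0" if "x > a + b - 2" for x
      by (rule tsupp_zero) (use s that in auto)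
    obtain w1 w2 where w: "test_fun w1" "test_fun w2" and cv:
      "\<forall>\<phi>. test_fun \<phi> \<longrightarrow> (\<forall>x>a + b - 2. \<phi> x = 0) \<longrightarrow>
          conv S T \<phi> = S (\<lambda>x. w1 x * T (\<lambda>y. w2 y * \<phi> (x + y)))"
      using ex[where c = "a + b - 2"] by (elim exE conjE) (rule that)
    have "T (\<lambda>y. w2 y * \<phi> (x + y)) = 0" if "x > a - 1" for x
      by (rule supp_geD[OF T(2), where d = "b - 1"])
         (use that in \<open>auto intro: test_fun_cutoff_shift w t \<phi>0\<close>)
    then show "conv S T \<phi> = 0"
      by (subst cv[rule_format, OF t \<phi>0], simp, intro supp_geD[OF S(2), where d = "a - 1"])
        (auto intro: test_fun_radon_shift w t T)
  qed
  ultimately show ?thesis by (auto simp: radon_plus_def)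
qed

section \<open>Order zero under sums, products and determinants\<close>

lemma radon_dirac: "radon (\<lambda>\<phi>. \<phi> c)"
  by (rule radonI) (auto intro!: exI[of _ 1])

lemma radon_plus_dirac0: "radon_plus dirac0"
proof -
  have "supp_ge dirac0 0" unfolding supp_ge_def dirac0_def using tsupp_zero by fastforce
  then show ?thesis using radon_dirac[of 0] unfolding radon_plus_def dirac0_def[abs_def] by blast
qed

lemma radon_plus_conv_prod: "(\<And>i. radon_plus (F i)) \<Longrightarrow> radon_plus (conv_prod F)"
proof -
  assume F: "\<And>i. radon_plus (F i)"
  have "radon_plus (foldr conv (map F xs) dirac0)" for xs
    by (induction xs) (auto intro: radon_plus_dirac0 radon_plus_conv F)
  then show ?thesis by (simp add: conv_prod_def)
qed

lemma radon_cmult_distr: "radon T \<Longrightarrow> radon (\<lambda>\<phi>. k * T \<phi>)"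
proof (rule radonI)
  fix a b assume T: "radon T"
  obtain C where C: "C \<ge> 0"
    "\<And>\<phi> M. test_fun \<phi> \<Longrightarrow> (\<And>x. \<phi> x \<noteq> 0 \<Longrightarrow> a \<le> x \<and> x \<le> b) \<Longrightarrow> (\<And>x. \<bar>\<phi> x\<bar> \<le> M) \<Longrightarrow> \<bar>T \<phi>\<bar> \<le> C * M"
    using radon_bound[OF T] by blast
  show "\<exists>C. \<forall>\<phi> M. test_fun \<phi> \<longrightarrow> (\<forall>x. \<phi> x \<noteq> 0 \<longrightarrow> a \<le> x \<and> x \<le> b) \<longrightarrow> (\<forall>x. \<bar>\<phi> x\<bar> \<le> M) \<longrightarrow> \<bar>k * T \<phi>\<bar> \<le> C * M"
    by (rule exI[of _ "\<bar>k\<bar> * C"]) (auto simp: abs_mult mult.assoc intro!: mult_left_mono C)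
qed (simp_all add: radon_add radon_cmult algebra_simps)

lemma radon_add_distr: "radon S \<Longrightarrow> radon T \<Longrightarrow> radon (\<lambda>\<phi>. S \<phi> + T \<phi>)"
proof (rule radonI)
  fix a b assume S: "radon S" and T: "radon T"
  obtain C where C: "C \<ge> 0"
    "\<And>\<phi> M. test_fun \<phi> \<Longrightarrow> (\<And>x. \<phi> x \<noteq> 0 \<Longrightarrow> a \<le> x \<and> x \<le> b) \<Longrightarrow> (\<And>x. \<bar>\<phi> x\<bar> \<le> M) \<Longrightarrow> \<bar>S \<phi>\<bar> \<le> C * M"
    using radon_bound[OF S] by blast
  obtain D where D: "D \<ge> 0"
    "\<And>\<phi> M. test_fun \<phi> \<Longrightarrow> (\<And>x. \<phi> x \<noteq> 0 \<Longrightarrow> a \<le> x \<and> x \<le> b) \<Longrightarrow> (\<And>x. \<bar>\<phi> x\<bar> \<le> M) \<Longrightarrow> \<bar>T \<phi>\<bar> \<le> D * M"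
    using radon_bound[OF T] by blast
  show "\<exists>C. \<forall>\<phi> M. test_fun \<phi> \<longrightarrow> (\<forall>x. \<phi> x \<noteq> 0 \<longrightarrow> a \<le> x \<and> x \<le> b) \<longrightarrow> (\<forall>x. \<bar>\<phi> x\<bar> \<le> M) \<longrightarrow>
      \<bar>S \<phi> + T \<phi>\<bar> \<le> C * M"
  proof (intro exI[of _ "C + D"] allI impI)
    fix \<phi> M assume "test_fun \<phi>" "\<forall>x. \<phi> x \<noteq> 0 \<longrightarrow> a \<le> x \<and> x \<le> b" "\<forall>x. \<bar>\<phi> x\<bar> \<le> M"
    then have "\<bar>S \<phi>\<bar> \<le> C * M" "\<bar>T \<phi>\<bar> \<le> D * M" using C D by blast+
    then show "\<bar>S \<phi> + T \<phi>\<bar> \<le> (C + D) * M" by (simp add: distrib_right)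
  qed
qed (simp_all add: radon_add radon_cmult algebra_simps)

lemma radon_zero_distr: "radon (\<lambda>\<phi>. 0)"
  by (rule radonI) (auto intro: exI[of _ 0])

lemma radon_sum_distr: "(\<And>i. i \<in> I \<Longrightarrow> radon (T i)) \<Longrightarrow> radon (\<lambda>\<phi>. \<Sum>i\<in>I. T i \<phi>)"
  by (induction I rule: infinite_finite_induct) (auto intro: radon_zero_distr radon_add_distr)

text \<open>The determinant is a finite linear combination of iterated convolutions, and each of
  these operations preserves order zero.\<close>

lemma order_zero_distr_det:
  assumes "\<And>i j. radon_plus (M i j)"
  shows "distr_order_zero (distr_det M)"
proof -
  have "radon (distr_det M)" unfolding distr_det_def
    using radon_plus_conv_prod[of "\<lambda>i. M i (p i)" for p] assms
    by (intro radon_sum_distr radon_cmult_distr) (simp add: radon_plus_def)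
  then show ?thesis by (simp add: radon_def)
qed

section \<open>The delay operator and its resolvent\<close>

text \<open>The norm on the matrix type is the Frobenius norm, so Cauchy-Schwarz in each row
  suffices.\<close>

lemma norm_matrix_vector_mult_le: "norm (M *v v) \<le> norm M * norm v"
  for M :: "real^'n^'m"
proof -
  have "norm (M *v v) = L2_set (\<lambda>i. \<bar>M $ i \<bullet> v\<bar>) UNIV"
    by (simp add: norm_vec_def matrix_vector_mul_component)
  also have "\<dots> \<le> L2_set (\<lambda>i. norm (M $ i) * norm v) UNIV"
    by (intro L2_set_mono Cauchy_Schwarz_ineq2) auto
  also have "\<dots> = norm M * norm v"
    by (simp add: L2_set_left_distrib norm_vec_def)
  finally show ?thesis .
qed

lemma bounded_bilinear_matrix_vector_mult:
  "bounded_bilinear (\<lambda>(M :: real^'n^'m) v. M *v v)"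
proof
  show "\<exists>K. \<forall>(M :: real^'n^'m) v. norm (M *v v) \<le> norm M * norm v * K"
    by (intro exI[of _ 1]) (simp add: norm_matrix_vector_mult_le)
qed (auto simp: matrix_vector_mult_add_rdistrib matrix_vector_right_distrib matrix_vector_mult_scaleR scaleR_matrix_vector_assoc)

lemma borel_measurable_matrix_vector_mult [measurable (raw)]:
  fixes f :: "'a \<Rightarrow> real^'n^'m"
  assumes "f \<in> borel_measurable M" "g \<in> borel_measurable M"
  shows "(\<lambda>x. f x *v g x) \<in> borel_measurable M"
proof (rule borel_measurable_continuous_Pair[OF assms])
  show "continuous_on UNIV (\<lambda>x :: (real^'n^'m) \<times> (real^'n). fst x *v snd x)"
    by (intro bounded_bilinear.continuous_on[OF bounded_bilinear_matrix_vector_mult] continuous_intros)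
qed

lemma borel_measurable_vec_nth_comp [measurable (raw)]:
  fixes f :: "'a \<Rightarrow> 'b::real_normed_vector^'n"
  assumes "f \<in> borel_measurable M"
  shows "(\<lambda>x. f x $ i) \<in> borel_measurable M"
  by (rule borel_measurable_continuous_on[OF _ assms]) (intro continuous_intros)

lemma integrable_indicator_Icc: "integrable lborel (indicat_real {a..b::real})"
  by (intro integrable_real_indicator) (auto simp: emeasure_lborel_Icc_eq)

lemma continuous_bounded_Icc:
  fixes f :: "real \<Rightarrow> 'a::real_normed_vector"
  assumes "continuous_on UNIV f"
  shows "\<exists>M. \<forall>y\<in>{a..b}. norm (f y) \<le> M"
proof -
  have "bounded (f ` {a..b})"
    by (intro compact_imp_bounded compact_continuous_image) (auto intro: continuous_on_subset[OF assms])
  then show ?thesis by (auto simp: bounded_iff)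
qed

section \<open>Contraction of the delay operator in an exponential weight\<close>

lemma exp_minus_le_inverse: "0 < t \<Longrightarrow> exp (- t) \<le> 1 / t" for t :: real
proof -
  assume "0 < t"
  moreover have "t \<le> exp t" using exp_ge_add_one_self[of t] by linarith
  ultimately have "1 / exp t \<le> 1 / t" by (intro frac_le) auto
  then show ?thesis by (simp add: exp_minus inverse_eq_divide)
qed

text \<open>A normalized form of the data: g is Borel, bounded at every point and extended by 0, so
  that its integrals run over the whole line. The final theorem reaches it by changing g on a null
  set, with L the largest delay.\<close>

locale delay =
  fixes N :: nat and \<Lambda> :: "nat \<Rightarrow> real" and A :: "nat \<Rightarrow> real^'d^'d" and g :: "real \<Rightarrow> real^'d^'d"
    and L C :: real
  assumes delay_pos: "\<And>j. j \<in> {1..N} \<Longrightarrow> 0 < \<Lambda> j" and delay_le: "\<And>j. j \<in> {1..N} \<Longrightarrow> \<Lambda> j \<le> L"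
    and L_nonneg: "0 \<le> L"
    and g_meas [measurable]: "g \<in> borel_measurable borel" and g_bound: "\<And>s. norm (g s) \<le> C"
    and g_zero: "\<And>s. s \<notin> {0..L} \<Longrightarrow> g s = 0"
begin

definition K :: "(real \<Rightarrow> real^'d) \<Rightarrow> real \<Rightarrow> real^'d" where
  "K \<psi> x = (\<Sum>j=1..N. A j *v \<psi> (x + \<Lambda> j)) + (LINT s|lborel. g s *v \<psi> (x + s))"

text \<open>With this weight the operator K contracts by 1/2, because
  exp (- t) is at most 1 / t.\<close>

definition rate :: real where
  "rate = 2 * ((\<Sum>j=1..N. norm (A j) / \<Lambda> j) + C) + 1"

lemma C_nonneg: "0 \<le> C" using g_bound[of 0] norm_ge_zero order_trans by blast

lemma rate_pos: "rate > 0"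
  unfolding rate_def using C_nonneg delay_pos
  by (intro add_nonneg_pos mult_nonneg_nonneg add_nonneg_nonneg sum_nonneg divide_nonneg_pos) auto

lemma K_integrable:
  assumes "continuous_on UNIV \<psi>"
  shows "integrable lborel (\<lambda>s. g s *v \<psi> (x + s))"
proof -
  obtain M where M: "\<And>y. y \<in> {x..x + L} \<Longrightarrow> norm (\<psi> y) \<le> M"
    using continuous_bounded_Icc[OF assms] by blast
  have [measurable]: "\<psi> \<in> borel_measurable borel"
    by (rule borel_measurable_continuous_onI[OF assms])
  show ?thesis
  proof (rule Bochner_Integration.integrable_bound)
    show "integrable lborel (\<lambda>s. indicator {0..L} s * (C * M))"
      by (intro integrable_mult_left integrable_indicator_Icc)
    have "norm (g s *v \<psi> (x + s)) \<le> norm (indicator {0..L} s * (C * M))" for s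
    proof (cases "s \<in> {0..L}")
      case True
      have "norm (g s *v \<psi> (x + s)) \<le> norm (g s) * norm (\<psi> (x + s))"
        by (rule norm_matrix_vector_mult_le)
      also have "\<dots> \<le> C * M" using True C_nonneg by (intro mult_mono g_bound M) auto
      finally show ?thesis using True by simp
    qed (simp add: g_zero)
    then show "AE s in lborel. norm (g s *v \<psi> (x + s)) \<le> norm (indicator {0..L} s * (C * M))"
      by simp
  qed simp
qed

lemma K_add:
  "continuous_on UNIV \<psi> \<Longrightarrow> continuous_on UNIV \<eta> \<Longrightarrow> K (\<lambda>x. \<psi> x + \<eta> x) x = K \<psi> x + K \<eta> x"
  by (simp add: K_def K_integrable matrix_vector_right_distrib sum.distrib)

lemma K_scaleR: "K (\<lambda>x. c *\<^sub>R \<psi> x) x = c *\<^sub>R K \<psi> x"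
  by (simp add: K_def matrix_vector_mult_scaleR scaleR_right_distrib scaleR_sum_right)

lemma K_zero: "K (\<lambda>x. 0) x = 0"
  by (simp add: K_def)

lemma K_diff:
  "continuous_on UNIV \<psi> \<Longrightarrow> continuous_on UNIV \<eta> \<Longrightarrow> K (\<lambda>x. \<psi> x - \<eta> x) x = K \<psi> x - K \<eta> x"
  using K_add[of \<psi> "\<lambda>x. (-1) *\<^sub>R \<eta> x"] K_scaleR[of "-1" \<eta>]
  by (simp add: continuous_on_minus)

lemma K_sum:
  "finite I \<Longrightarrow> (\<And>i. continuous_on UNIV (\<psi> i)) \<Longrightarrow> K (\<lambda>x. \<Sum>i\<in>I. \<psi> i x) x = (\<Sum>i\<in>I. K (\<psi> i) x)"
  by (induction I rule: finite_induct) (simp_all add: K_zero K_add continuous_on_sum)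

text \<open>A convergent sequence is bounded, so all shifted arguments with s in [0, L] stay in one
  compact interval, and dominated convergence applies.\<close>

lemma K_continuous:
  assumes "continuous_on UNIV \<psi>"
  shows "continuous_on UNIV (K \<psi>)"
proof -
  have [measurable]: "\<psi> \<in> borel_measurable borel"
    by (rule borel_measurable_continuous_onI[OF assms])
  have \<psi>c: "isCont \<psi> y" for y using assms by (simp add: continuous_on_eq_continuous_at)
  have "isCont (\<lambda>x. LINT s|lborel. g s *v \<psi> (x + s)) x" for x
    unfolding continuous_at_sequentially comp_def
  proof (intro allI impI)
    fix u assume u: "u \<longlonglongrightarrow> x"
    then obtain R where R: "\<And>n. \<bar>u n\<bar> \<le> R"
      using convergent_imp_bounded[of u x] by (auto simp: bounded_iff)
    obtain M where M: "\<And>y. y \<in> {-R..R + L} \<Longrightarrow> norm (\<psi> y) \<le> M"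
      using continuous_bounded_Icc[OF assms] by blast
    show "(\<lambda>n. LINT s|lborel. g s *v \<psi> (u n + s)) \<longlonglongrightarrow> (LINT s|lborel. g s *v \<psi> (x + s))"
    proof (rule integral_dominated_convergence[where w = "\<lambda>s. indicator {0..L} s * (C * M)"])
      have "(\<lambda>n. g s *v \<psi> (u n + s)) \<longlonglongrightarrow> g s *v \<psi> (x + s)" for s
        by (intro bounded_bilinear.tendsto[OF bounded_bilinear_matrix_vector_mult] tendsto_const
              isCont_tendsto_compose[OF \<psi>c] tendsto_add u)
      then show "AE s in lborel. (\<lambda>n. g s *v \<psi> (u n + s)) \<longlonglongrightarrow> g s *v \<psi> (x + s)" by simp
      have "norm (g s *v \<psi> (u n + s)) \<le> indicator {0..L} s * (C * M)" for s n
      proof (cases "s \<in> {0..L}")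
        case True
        have "norm (g s *v \<psi> (u n + s)) \<le> norm (g s) * norm (\<psi> (u n + s))"
          by (rule norm_matrix_vector_mult_le)
        also have "\<dots> \<le> C * M" using True C_nonneg R[of n] by (intro mult_mono g_bound M) auto
        finally show ?thesis using True by simp
      qed (simp add: g_zero)
      then show "AE s in lborel. norm (g s *v \<psi> (u n + s)) \<le> indicator {0..L} s * (C * M)" for n
        by simp
    qed (auto intro: integrable_mult_left integrable_indicator_Icc)
  qed
  then have "continuous_on UNIV (\<lambda>x. LINT s|lborel. g s *v \<psi> (x + s))"
    by (simp add: continuous_on_eq_continuous_at)
  moreover have "continuous_on UNIV (\<lambda>x. \<psi> (x + c))" for c
    by (rule continuous_on_compose2[OF assms]) (auto intro: continuous_intros)
  ultimately show ?thesis
    unfolding K_def[abs_def]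
    by (intro continuous_on_add continuous_on_sum
          bounded_bilinear.continuous_on[OF bounded_bilinear_matrix_vector_mult]) auto
qed

lemma integral_exp_rate: "(LINT s|lborel. exp (- rate * s) * indicator {0..L} s) \<le> 1 / rate"
proof -
  have "(LINT s|lborel. exp (- rate * s) * indicator {0..L} s) =
      (- exp (- rate * L) / rate) - (- exp (- rate * 0) / rate)"
  proof (rule integral_FTC_Icc_real[OF L_nonneg])
    show "((\<lambda>s. - exp (- rate * s) / rate) has_real_derivative exp (- rate * s)) (at s)" for s
      using rate_pos by (auto intro!: derivative_eq_intros)
    show "isCont (\<lambda>s. exp (- rate * s)) s" for s by (intro continuous_intros)
  qed
  also have "\<dots> \<le> 1 / rate" using rate_pos by simp
  finally show ?thesis .
qed

text \<open>K looks only to the right, so a bound on {a..} controls K there. In the weight, a point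
  delay loses at least a factor rate times \<open>\<Lambda> j\<close>, and integrating over the
  distributed delay yields 1 / rate.\<close>

lemma K_weight_bound:
  assumes \<psi>: "continuous_on UNIV \<psi>" and H: "\<And>y. y \<ge> a \<Longrightarrow> exp (rate * y) * norm (\<psi> y) \<le> H"
    and x: "x \<ge> a"
  shows "exp (rate * x) * norm (K \<psi> x) \<le> H / 2"
proof -
  have H0: "0 \<le> H"
    by (rule order_trans[OF _ H[of a]]) auto
  have \<psi>le: "norm (\<psi> (x + s)) \<le> exp (- rate * x) * (exp (- rate * s) * H)" if "s \<ge> 0" for s
  proof -
    have "exp (- (rate * (x + s))) * (exp (rate * (x + s)) * norm (\<psi> (x + s))) \<le>
        exp (- (rate * (x + s))) * H"
      using that x by (intro mult_left_mono H) auto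
    moreover have "exp (- (rate * (x + s))) * (exp (rate * (x + s)) * norm (\<psi> (x + s))) =
        norm (\<psi> (x + s))"
      by (simp add: exp_minus)
    moreover have "exp (- (rate * (x + s))) = exp (- rate * x) * exp (- rate * s)"
      by (simp add: algebra_simps flip: exp_add)
    ultimately show ?thesis by (simp only: mult.assoc)
  qed
  have "norm (\<Sum>j=1..N. A j *v \<psi> (x + \<Lambda> j)) \<le>
      (\<Sum>j=1..N. norm (A j) * (exp (- rate * x) * ((1 / (rate * \<Lambda> j)) * H)))"
  proof (rule order_trans[OF norm_sum], rule sum_mono)
    fix j assume j: "j \<in> {1..N}"
    have "norm (A j *v \<psi> (x + \<Lambda> j)) \<le> norm (A j) * norm (\<psi> (x + \<Lambda> j))"
      by (rule norm_matrix_vector_mult_le)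
    also have "\<dots> \<le> norm (A j) * (exp (- rate * x) * (exp (- rate * \<Lambda> j) * H))"
      using delay_pos[OF j] by (intro mult_left_mono \<psi>le) auto
    also have "\<dots> \<le> norm (A j) * (exp (- rate * x) * ((1 / (rate * \<Lambda> j)) * H))"
      using exp_minus_le_inverse[of "rate * \<Lambda> j"] rate_pos delay_pos[OF j] H0
      by (intro mult_left_mono mult_right_mono) auto
    finally show "norm (A j *v \<psi> (x + \<Lambda> j)) \<le>
        norm (A j) * (exp (- rate * x) * ((1 / (rate * \<Lambda> j)) * H))" .
  qed
  also have "\<dots> = exp (- rate * x) * (H / rate) * (\<Sum>j=1..N. norm (A j) / \<Lambda> j)"
    unfolding sum_distrib_left by (intro sum.cong) auto
  finally have 1: "norm (\<Sum>j=1..N. A j *v \<psi> (x + \<Lambda> j)) \<le>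
      exp (- rate * x) * (H / rate) * (\<Sum>j=1..N. norm (A j) / \<Lambda> j)" .
  have int: "integrable lborel (\<lambda>s. exp (- rate * s) * indicator {0..L} s)"
    by (intro borel_integrable_atLeastAtMost continuous_intros)
  have "norm (LINT s|lborel. g s *v \<psi> (x + s)) \<le>
      (LINT s|lborel. (C * exp (- rate * x) * H) * (exp (- rate * s) * indicator {0..L} s))"
  proof (rule Bochner_Integration.integral_norm_bound_integral)
    show "integrable lborel (\<lambda>s. (C * exp (- rate * x) * H) * (exp (- rate * s) * indicator {0..L} s))"
      using int by (rule integrable_mult_right)
    fix s
    show "norm (g s *v \<psi> (x + s)) \<le>
        (C * exp (- rate * x) * H) * (exp (- rate * s) * indicator {0..L} s)"
    proof (cases "s \<in> {0..L}")
      case True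
      have "norm (g s *v \<psi> (x + s)) \<le> norm (g s) * norm (\<psi> (x + s))"
        by (rule norm_matrix_vector_mult_le)
      also have "\<dots> \<le> C * (exp (- rate * x) * (exp (- rate * s) * H))"
        using True C_nonneg by (intro mult_mono g_bound \<psi>le) auto
      finally show ?thesis using True by (simp add: mult_ac)
    qed (simp add: g_zero)
  qed (rule K_integrable[OF \<psi>])
  also have "\<dots> \<le> (C * exp (- rate * x) * H) * (1 / rate)"
    unfolding integral_mult_right_zero
    using C_nonneg H0 by (intro mult_left_mono integral_exp_rate) auto
  also have "\<dots> = exp (- rate * x) * (H / rate) * C" by simp
  finally have "norm (K \<psi> x) \<le> exp (- rate * x) * (H / rate) * ((\<Sum>j=1..N. norm (A j) / \<Lambda> j) + C)"
    using 1 unfolding K_def distrib_left by (intro norm_triangle_le) linarith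
  \<comment> \<open>The left side equals (rate - 1) / 2: hence the factor 2 in \<open>rate\<close>,
    while its summand 1 keeps it positive.\<close>
  also have "(\<Sum>j=1..N. norm (A j) / \<Lambda> j) + C \<le> rate / 2"
    by (simp add: rate_def)
  then have "exp (- rate * x) * (H / rate) * ((\<Sum>j=1..N. norm (A j) / \<Lambda> j) + C) \<le>
      exp (- rate * x) * (H / rate) * (rate / 2)"
    using H0 rate_pos by (intro mult_left_mono) auto
  also have "\<dots> = exp (- rate * x) * (H / 2)" using rate_pos by simp
  finally have "exp (rate * x) * norm (K \<psi> x) \<le> exp (rate * x) * (exp (- rate * x) * (H / 2))"
    by (intro mult_left_mono) auto
  moreover have "exp (rate * x) * (exp (- rate * x) * (H / 2)) = H / 2"
    by (simp add: exp_minus)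
  ultimately show ?thesis by (simp only:)
qed

text \<open>Absorption: the weighted supremum S satisfies S \<le> H + S / 2. The bound B only
  ensures that S is finite and does not enter the result.\<close>

lemma apriori_bound:
  assumes \<psi>: "continuous_on UNIV \<psi>" and bdd: "\<And>x. x \<ge> a \<Longrightarrow> exp (rate * x) * norm (\<psi> x) \<le> B"
    and eq: "\<And>x. x \<ge> a \<Longrightarrow> \<psi> x = \<theta> x + K \<psi> x"
    and H: "\<And>x. x \<ge> a \<Longrightarrow> exp (rate * x) * norm (\<theta> x) \<le> H"
    and x: "x \<ge> a"
  shows "exp (rate * x) * norm (\<psi> x) \<le> 2 * H"
proof -
  define S where "S = (\<lambda>x. exp (rate * x) * norm (\<psi> x)) ` {a..}"
  have ne: "S \<noteq> {}" and ba: "bdd_above S" using bdd by (auto simp: S_def bdd_above_def)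
  have up: "exp (rate * y) * norm (\<psi> y) \<le> Sup S" if "y \<ge> a" for y
    using that ba by (intro cSup_upper) (auto simp: S_def)
  have "exp (rate * y) * norm (\<psi> y) \<le> H + Sup S / 2" if "y \<ge> a" for y
  proof -
    have "norm (\<psi> y) \<le> norm (\<theta> y) + norm (K \<psi> y)"
      using eq[OF that] norm_triangle_ineq by metis
    then have "exp (rate * y) * norm (\<psi> y) \<le> exp (rate * y) * norm (\<theta> y) +
        exp (rate * y) * norm (K \<psi> y)"
      by (simp flip: distrib_left)
    then show ?thesis using H[OF that] K_weight_bound[OF \<psi> up that] by linarith
  qed
  then have "Sup S \<le> H + Sup S / 2" by (intro cSup_least[OF ne]) (auto simp: S_def)
  then show ?thesis using up[OF x] by linarith
qed

text \<open>Vanishing near + infinity makes the weighted supremum over any half-line {a..} finite,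
  as absorption requires. Towards - infinity a resolvent solution need not vanish, so compact
  support would be too much to ask.\<close>

definition vanishing :: "(real \<Rightarrow> real^'d) \<Rightarrow> bool" where
  "vanishing \<psi> \<longleftrightarrow> continuous_on UNIV \<psi> \<and> (\<exists>c. \<forall>x>c. \<psi> x = 0)"

lemma vanishing_bounded:
  assumes "vanishing \<psi>"
  shows "\<exists>B. \<forall>x\<ge>a. exp (rate * x) * norm (\<psi> x) \<le> B"
proof -
  obtain c where c: "\<And>x. x > c \<Longrightarrow> \<psi> x = 0" using assms by (auto simp: vanishing_def)
  have "continuous_on UNIV (\<lambda>x. exp (rate * x) * norm (\<psi> x))"
    using assms by (intro continuous_intros) (simp add: vanishing_def)
  then obtain B where B: "\<forall>x\<in>{a..c}. norm (exp (rate * x) * norm (\<psi> x)) \<le> B"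
    using continuous_bounded_Icc by blast
  have "exp (rate * x) * norm (\<psi> x) \<le> max B 0" if "x \<ge> a" for x
  proof (cases "x \<le> c")
    case True
    then show ?thesis using B[rule_format, of x] that by simp
  qed (use c in simp)
  then show ?thesis by blast
qed

text \<open>The difference solves the homogeneous equation on {a..}, so the a priori bound applies
  with H = 0. Needing the equation on that half-line only is what makes the inverse local.\<close>

lemma vanishing_unique:
  assumes "vanishing \<psi>" "vanishing \<eta>"
    "\<And>x. x \<ge> a \<Longrightarrow> \<psi> x = \<theta> x + K \<psi> x" "\<And>x. x \<ge> a \<Longrightarrow> \<eta> x = \<theta> x + K \<eta> x" "x \<ge> a"
  shows "\<psi> x = \<eta> x"
proof -
  let ?d = "\<lambda>x. \<psi> x - \<eta> x"
  have c: "continuous_on UNIV \<psi>" "continuous_on UNIV \<eta>" using assms by (auto simp: vanishing_def)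
  obtain c1 c2 where "\<forall>x>c1. \<psi> x = 0" "\<forall>x>c2. \<eta> x = 0" using assms by (auto simp: vanishing_def)
  then have "\<forall>x>max c1 c2. ?d x = 0" by auto
  then have "vanishing ?d" unfolding vanishing_def using continuous_on_diff[OF c] by blast
  then obtain B where B: "\<And>x. x \<ge> a \<Longrightarrow> exp (rate * x) * norm (?d x) \<le> B"
    using vanishing_bounded by blast
  have "exp (rate * x) * norm (?d x) \<le> 2 * 0"
  proof (rule apriori_bound[where \<theta> = "\<lambda>x. 0"])
    show "?d y = 0 + K ?d y" if "y \<ge> a" for y
      using assms(3,4)[OF that] K_diff[OF c, of y] by simp
  qed (use B c assms(5) in \<open>auto intro: continuous_on_diff\<close>)
  then have "norm (?d x) \<le> 0" by (simp add: mult_le_0_iff)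
  then show ?thesis by simp
qed

lemma resolvent_exists:
  assumes \<theta>: "continuous_on UNIV \<theta>" "\<And>x. norm (\<theta> x) \<le> B" "\<And>x. x > c \<Longrightarrow> \<theta> x = 0"
  shows "\<exists>\<psi>. vanishing \<psi> \<and> (\<forall>x. \<psi> x = \<theta> x + K \<psi> x)"
proof -
  \<comment> \<open>D removes the weight. With f = exp (rate * x) times the unknown, the weighted
    norm becomes the sup norm, and the complete space of bounded continuous functions is
    available.\<close>
  define D where "D f = (\<lambda>y. exp (- (rate * y)) *\<^sub>R f y)" for f :: "real \<Rightarrow> real^'d"
  define F where "F f = (\<lambda>x. exp (rate * x) *\<^sub>R (\<theta> x + K (D f) x))" for f
  have D_cont: "continuous_on UNIV (D f)" if "continuous_on UNIV f" for f
    unfolding D_def using that by (intro continuous_intros) auto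
  have D_norm: "exp (rate * y) * norm (D f y) = norm (f y)" for f y
    by (simp add: D_def exp_minus)
  have KD: "exp (rate * x) * norm (K (D f) x) \<le> M / 2"
    if "continuous_on UNIV f" "\<And>y. norm (f y) \<le> M" for f M x
    by (rule K_weight_bound[where a = x]) (use that D_cont D_norm in auto)
  have F: "F (apply_bcontfun f) \<in> bcontfun" for f
  proof -
    have cf: "continuous_on UNIV (apply_bcontfun f)"
      using apply_bcontfun[of f] by (simp add: bcontfun_def)
    have "continuous_on UNIV (F (apply_bcontfun f))"
      unfolding F_def using \<theta>(1) K_continuous[OF D_cont[OF cf]] by (intro continuous_intros) auto
    \<comment> \<open>The weight increases and \<open>\<theta>\<close> vanishes beyond c, so the
      weighted \<open>\<theta>\<close> is largest at c at worst; at - infinity the weight only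
      helps.\<close>
    moreover have "norm (F (apply_bcontfun f) x) \<le> exp (rate * c) * B + norm f / 2" for x
    proof -
      have B0: "B \<ge> 0" using \<theta>(2)[of 0] norm_ge_zero order_trans by blast
      have "exp (rate * x) * norm (\<theta> x) \<le> exp (rate * c) * B"
      proof (cases "x \<le> c")
        case True
        then show ?thesis using rate_pos by (intro mult_mono \<theta>) auto
      qed (use \<theta>(3) B0 in auto)
      moreover have "exp (rate * x) * norm (K (D (apply_bcontfun f)) x) \<le> norm f / 2"
        by (rule KD[OF cf norm_bounded])
      moreover have "norm (F (apply_bcontfun f) x) \<le> exp (rate * x) * norm (\<theta> x) +
          exp (rate * x) * norm (K (D (apply_bcontfun f)) x)"
        unfolding F_def by (simp add: norm_triangle_ineq flip: distrib_left)
      ultimately show ?thesis by linarith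
    qed
    ultimately show ?thesis by (auto simp: bcontfun_def bounded_iff)
  qed
  define \<Phi> where "\<Phi> f = Bcontfun (F (apply_bcontfun f))" for f
  have \<Phi>: "apply_bcontfun (\<Phi> f) = F (apply_bcontfun f)" for f
    unfolding \<Phi>_def by (rule Bcontfun_inverse[OF F])
  have "dist (\<Phi> f) (\<Phi> h) \<le> 1/2 * dist f h" for f h
  proof (rule dist_bound)
    fix x
    have cf: "continuous_on UNIV (apply_bcontfun f)" "continuous_on UNIV (apply_bcontfun h)"
      using apply_bcontfun[of f] apply_bcontfun[of h] by (auto simp: bcontfun_def)
    have "F (apply_bcontfun f) x - F (apply_bcontfun h) x =
        exp (rate * x) *\<^sub>R (K (D (apply_bcontfun f)) x - K (D (apply_bcontfun h)) x)"
      by (simp add: F_def algebra_simps)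
    also have "K (D (apply_bcontfun f)) x - K (D (apply_bcontfun h)) x =
        K (D (apply_bcontfun (f - h))) x"
      using K_diff[OF D_cont[OF cf(1)] D_cont[OF cf(2)], of x]
      by (simp add: D_def scaleR_diff_right)
    finally have "dist (F (apply_bcontfun f) x) (F (apply_bcontfun h) x) =
        exp (rate * x) * norm (K (D (apply_bcontfun (f - h))) x)"
      by (simp add: dist_norm)
    also have "\<dots> \<le> norm (f - h) / 2"
      by (rule KD) (use apply_bcontfun[of "f - h"] norm_bounded[of "f - h"] in \<open>auto simp: bcontfun_def\<close>)
    finally show "dist (apply_bcontfun (\<Phi> f) x) (apply_bcontfun (\<Phi> h) x) \<le> 1/2 * dist f h"
      by (simp add: \<Phi> dist_norm)
  qed
  then have "\<exists>!f. \<Phi> f = f" by (intro banach_fix_type[of "1/2"]) auto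
  then obtain f where "\<Phi> f = f" by blast
  then have f: "apply_bcontfun f = F (apply_bcontfun f)" using \<Phi> by metis
  have cf: "continuous_on UNIV (apply_bcontfun f)"
    using apply_bcontfun[of f] by (simp add: bcontfun_def)
  define \<psi> where "\<psi> = D (apply_bcontfun f)"
  have c\<psi>: "continuous_on UNIV \<psi>" using D_cont[OF cf] by (simp add: \<psi>_def)
  have eq: "\<psi> x = \<theta> x + K \<psi> x" for x
  proof -
    have "\<psi> x = exp (- (rate * x)) *\<^sub>R F (apply_bcontfun f) x"
      unfolding \<psi>_def D_def using f by metis
    then show ?thesis by (simp add: F_def \<psi>_def exp_minus)
  qed
  \<comment> \<open>On the half-line starting at x the right-hand side is 0, so the a priori bound
    forces 0. Finiteness of the weighted supremum comes from f being a bounded function.\<close>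
  have "\<psi> x = 0" if "x > c" for x
  proof -
    have "exp (rate * x) * norm (\<psi> x) \<le> 2 * 0"
    proof (rule apriori_bound[OF c\<psi> _ eq])
      show "exp (rate * y) * norm (\<psi> y) \<le> norm f" for y
        unfolding \<psi>_def D_norm by (rule norm_bounded)
    qed (use that \<theta>(3) in auto)
    then have "norm (\<psi> x) \<le> 0" by (simp add: mult_le_0_iff)
    then show ?thesis by simp
  qed
  then have "vanishing \<psi>" using c\<psi> by (auto simp: vanishing_def)
  then show ?thesis using eq by blast
qed

end

section \<open>Locally integrable functions as distributions\<close>

lemma integrable_cutoff:
  fixes f :: "real \<Rightarrow> 'a::euclidean_space"
  assumes f: "set_integrable lborel {a..b} f" and \<phi>: "continuous_on UNIV \<phi>"
    and s: "\<And>x. \<phi> x \<noteq> 0 \<Longrightarrow> a \<le> x \<and> x \<le> b"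
  shows "integrable lborel (\<lambda>s. \<phi> s *\<^sub>R f s)"
    and "(\<And>x. \<bar>\<phi> x\<bar> \<le> M) \<Longrightarrow>
      norm (LINT s|lborel. \<phi> s *\<^sub>R f s) \<le> (LINT s|lborel. norm (indicator {a..b} s *\<^sub>R f s)) * M"
proof -
  have i: "integrable lborel (\<lambda>s. indicator {a..b} s *\<^sub>R f s)"
    using f by (simp add: set_integrable_def)
  \<comment> \<open>f is known to be integrable only on [a, b]; inserting the indicator is what
    makes the product measurable.\<close>
  have eq: "(\<lambda>s. \<phi> s *\<^sub>R f s) = (\<lambda>s. \<phi> s *\<^sub>R (indicator {a..b} s *\<^sub>R f s))"
    using s by (force simp: indicator_def)
  have [measurable]: "\<phi> \<in> borel_measurable borel"
    by (rule borel_measurable_continuous_onI[OF \<phi>])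
  have [measurable]: "(\<lambda>s. indicator {a..b} s *\<^sub>R f s) \<in> borel_measurable lborel"
    using i by (rule borel_measurable_integrable)
  have bd: "norm (\<phi> x *\<^sub>R f x) \<le> norm (indicator {a..b} x *\<^sub>R f x) * M" if "\<And>x. \<bar>\<phi> x\<bar> \<le> M" for x M
  proof (cases "x \<in> {a..b}")
    case True
    then show ?thesis using that[of x] by (simp add: mult.commute[of _ M] mult_right_mono)
  next
    case False
    then have "\<phi> x = 0" using s by auto
    then show ?thesis using False by simp
  qed
  obtain M0 where "\<forall>y\<in>{a..b}. norm (\<phi> y) \<le> M0" using continuous_bounded_Icc[OF \<phi>] by blast
  then have M0: "\<bar>\<phi> y\<bar> \<le> max M0 0" for y using s[of y]
      by (cases "\<phi> y = 0") (auto simp: le_max_iff_disj)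
  show int: "integrable lborel (\<lambda>s. \<phi> s *\<^sub>R f s)"
  proof (rule Bochner_Integration.integrable_bound)
    show "integrable lborel (\<lambda>x. norm (indicator {a..b} x *\<^sub>R f x) * max M0 0)"
      by (intro integrable_mult_left integrable_norm i)
    show "(\<lambda>s. \<phi> s *\<^sub>R f s) \<in> borel_measurable lborel" unfolding eq by measurable
    show "AE x in lborel. norm (\<phi> x *\<^sub>R f x) \<le> norm (norm (indicator {a..b} x *\<^sub>R f x) * max M0 0)"
      using bd[OF M0] by (intro AE_I2) (simp add: abs_mult)
  qed
  show "norm (LINT s|lborel. \<phi> s *\<^sub>R f s) \<le> (LINT s|lborel. norm (indicator {a..b} s *\<^sub>R f s)) * M"
    if "\<And>x. \<bar>\<phi> x\<bar> \<le> M"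
  proof -
    have "norm (LINT s|lborel. \<phi> s *\<^sub>R f s) \<le>
        (LINT s|lborel. norm (indicator {a..b} s *\<^sub>R f s) * M)"
      by (rule Bochner_Integration.integral_norm_bound_integral[OF int _ bd[OF that]])
         (intro integrable_mult_left integrable_norm i)
    then show ?thesis by simp
  qed
qed

lemma set_integrable_bounded_linear:
  assumes "bounded_linear T" "set_integrable M S f"
  shows "set_integrable M S (\<lambda>x. T (f x))"
  using integrable_bounded_linear[OF assms(1) assms(2)[unfolded set_integrable_def]]
  by (simp add: set_integrable_def linear_simps[OF assms(1)])

lemma radon_fun_distr:
  assumes f: "\<And>a b. set_integrable lborel {a..b} f"
  shows "radon (fun_distr f)"
proof (rule radonI)
  have i: "integrable lborel (\<lambda>t. f t * \<phi> t)" if t: "test_fun \<phi>" for \<phi>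
  proof -
    obtain a b where "\<And>x. \<phi> x \<noteq> 0 \<Longrightarrow> a \<le> x \<and> x \<le> b" using test_fun_support[OF t] by blast
    from integrable_cutoff(1)[OF f test_fun_continuous[OF t] this]
    show ?thesis by (simp add: mult.commute)
  qed
  show "fun_distr f (\<lambda>x. \<phi> x + \<psi> x) = fun_distr f \<phi> + fun_distr f \<psi>" if "test_fun \<phi>"
      "test_fun \<psi>" for \<phi> \<psi>
    using i that by (simp add: fun_distr_def distrib_left)
  show "fun_distr f (\<lambda>x. c * \<phi> x) = c * fun_distr f \<phi>" for c \<phi>
    by (simp add: fun_distr_def mult.left_commute)
  fix a b
  show "\<exists>C. \<forall>\<phi> M. test_fun \<phi> \<longrightarrow> (\<forall>x. \<phi> x \<noteq> 0 \<longrightarrow> a \<le> x \<and> x \<le> b) \<longrightarrow> (\<forall>x. \<bar>\<phi> x\<bar> \<le> M) \<longrightarrow>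
      \<bar>fun_distr f \<phi>\<bar> \<le> C * M"
  proof (intro exI allI impI)
    fix \<phi> M assume "test_fun \<phi>" "\<forall>x. \<phi> x \<noteq> 0 \<longrightarrow> a \<le> x \<and> x \<le> b" "\<forall>x. \<bar>\<phi> x\<bar> \<le> M"
    then show "\<bar>fun_distr f \<phi>\<bar> \<le> (LINT s|lborel. norm (indicator {a..b} s *\<^sub>R f s)) * M"
      using integrable_cutoff(2)[OF f[of a b] test_fun_continuous, of \<phi> M]
      by (simp add: fun_distr_def mult.commute)
  qed
qed

lemma supp_ge_fun_distr:
  assumes "AE t in lborel. t < b \<longrightarrow> f t = 0"
  shows "supp_ge (fun_distr f) b"
  unfolding supp_ge_def
proof (intro allI impI)
  fix \<phi> assume "test_fun \<phi>" "tsupp \<phi> \<inter> {b..} = {}"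
  then have "\<phi> t = 0" if "t \<ge> b" for t using that by (intro tsupp_zero) auto
  then have "AE t in lborel. f t * \<phi> t = 0"
    using assms by (auto elim!: eventually_mono)
  then show "fun_distr f \<phi> = 0" unfolding fun_distr_def by (rule integral_eq_zero_AE)
qed

text \<open>For t ranging over [- R, R] the shifted supports stay in [a - R, b + R], where X is
  integrable and provides the dominating function.\<close>

lemma continuous_integral_shift:
  fixes X :: "real \<Rightarrow> 'a::euclidean_space"
  assumes X: "\<And>a b. set_integrable lborel {a..b} X" and Xm[measurable]: "X \<in> borel_measurable borel"
    and \<phi>: "test_fun \<phi>"
  shows "continuous_on UNIV (\<lambda>t. LINT s|lborel. \<phi> (t + s) *\<^sub>R X s)"
proof -
  obtain a b where ab: "\<And>x. \<phi> x \<noteq> 0 \<Longrightarrow> a \<le> x \<and> x \<le> b" using test_fun_support[OF \<phi>] by blast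
  obtain M where M: "M \<ge> 0" "\<And>x. \<bar>\<phi> x\<bar> \<le> M" using test_fun_bounded[OF \<phi>] by blast
  have c: "isCont \<phi> y" for y
    using test_fun_continuous[OF \<phi>, of UNIV] by (simp add: continuous_on_eq_continuous_at)
  have [measurable]: "\<phi> \<in> borel_measurable borel"
    by (rule borel_measurable_continuous_onI[OF test_fun_continuous[OF \<phi>]])
  have "isCont (\<lambda>t. LINT s|lborel. \<phi> (t + s) *\<^sub>R X s) t" for t
    unfolding continuous_at_sequentially comp_def
  proof (intro allI impI)
    fix u assume u: "u \<longlonglongrightarrow> t"
    then obtain R where R: "\<And>n. \<bar>u n\<bar> \<le> R"
      using convergent_imp_bounded[of u t] by (auto simp: bounded_iff)
    have i: "integrable lborel (\<lambda>s. indicator {a - R..b + R} s *\<^sub>R X s)"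
      using X by (simp add: set_integrable_def)
    show "(\<lambda>n. LINT s|lborel. \<phi> (u n + s) *\<^sub>R X s) \<longlonglongrightarrow> (LINT s|lborel. \<phi> (t + s) *\<^sub>R X s)"
    proof (rule integral_dominated_convergence[where w = "\<lambda>s. M * norm (indicator {a - R..b +
        R} s *\<^sub>R X s)"])
      have "(\<lambda>n. \<phi> (u n + s) *\<^sub>R X s) \<longlonglongrightarrow> \<phi> (t + s) *\<^sub>R X s" for s
        by (intro tendsto_scaleR tendsto_const isCont_tendsto_compose[OF c] tendsto_add u)
      then show "AE s in lborel. (\<lambda>n. \<phi> (u n + s) *\<^sub>R X s) \<longlonglongrightarrow> \<phi> (t + s) *\<^sub>R X s" by simp
      have "norm (\<phi> (u n + s) *\<^sub>R X s) \<le> M * norm (indicator {a - R..b + R} s *\<^sub>R X s)" for s n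
      proof (cases "s \<in> {a - R..b + R}")
        case True
        then show ?thesis using M(2)[of "u n + s"] by (simp add: mult_right_mono)
      next
        case False
        then have "\<not> (a \<le> u n + s \<and> u n + s \<le> b)" using R[of n] by auto
        then have "\<phi> (u n + s) = 0" using ab by blast
        then show ?thesis using M(1) by simp
      qed
      then show "AE s in lborel. norm (\<phi> (u n + s) *\<^sub>R X s) \<le> M * norm (indicator {a - R..b +
          R} s *\<^sub>R X s)" for n
        by simp
      show "integrable lborel (\<lambda>s. M * norm (indicator {a - R..b + R} s *\<^sub>R X s))"
        by (intro integrable_mult_right integrable_norm i)
    qed measurable
  qed
  then show ?thesis by (simp add: continuous_on_eq_continuous_at)
qed

text \<open>On a bounded interval the inequality r \<le> 1 + r^q, split at r = 1, gives an
  integrable majorant.\<close>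

lemma Lq_imp_L1:
  fixes x :: "real \<Rightarrow> 'a::euclidean_space"
  assumes "1 \<le> q" and [measurable]: "x \<in> borel_measurable borel"
    and "set_integrable lborel {a..b} (\<lambda>t. norm (x t) powr q)"
  shows "set_integrable lborel {a..b} x"
  unfolding set_integrable_def
proof (rule Bochner_Integration.integrable_bound)
  show "integrable lborel (\<lambda>t. indicator {a..b} t + indicator {a..b} t *\<^sub>R (norm (x t) powr q))"
    using assms(3) by (intro Bochner_Integration.integrable_add integrable_indicator_Icc) (simp add: set_integrable_def)
  have "r \<le> 1 + r powr q" if "r \<ge> 0" for r :: real
  proof (cases "r \<le> 1")
    case False
    then have "r powr 1 \<le> r powr q" using assms(1) by (intro powr_mono) auto
    then show ?thesis using False by simp
  qed (use that powr_ge_zero[of r q] in linarith)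
  then have "norm (indicator {a..b} t *\<^sub>R x t) \<le> norm (indicator {a..b} t +
      indicator {a..b} t *\<^sub>R (norm (x t) powr q))" for t
    by (cases "t \<in> {a..b}") (auto simp: abs_of_nonneg)
  then show "AE t in lborel. norm (indicator {a..b} t *\<^sub>R x t) \<le> norm (indicator {a..b} t +
      indicator {a..b} t *\<^sub>R (norm (x t) powr q))"
    by simp
qed measurable

text \<open>Rational bounds exhaust D up to a possible maximum, which is a null set.\<close>

lemma AE_below_lower_set:
  fixes D :: "real set"
  assumes dc: "\<And>s t. t \<in> D \<Longrightarrow> s \<le> t \<Longrightarrow> s \<in> D"
    and P: "\<And>\<tau>. \<tau> \<in> D \<Longrightarrow> AE s in lborel. s < \<tau> \<longrightarrow> P s"
  shows "AE s in lborel. s \<in> D \<longrightarrow> P s"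
proof -
  define E where "E = {s \<in> D. \<forall>t\<in>D. t \<le> s}"
  have "\<exists>z. E \<subseteq> {z}"
  proof (cases "E = {}")
    case False
    then obtain z where "z \<in> E" by blast
    then show ?thesis unfolding E_def by (intro exI[of _ z]) (auto intro: antisym)
  qed auto
  then obtain z where z: "E \<subseteq> {z}" by blast
  have "AE s in lborel. \<forall>r\<in>\<rat> \<inter> D. s < r \<longrightarrow> P s"
    using P by (subst AE_ball_countable) (auto intro: countable_subset[OF _ countable_rat])
  moreover have "AE s in lborel. s \<noteq> z" by (rule AE_lborel_singleton)
  ultimately show ?thesis
  proof eventually_elim
    case (elim s)
    show ?case
    proof
      assume s: "s \<in> D"
      have "s \<notin> E" using z elim(2) by blast
      then obtain t where t: "t \<in> D" "s < t" using s by (auto simp: E_def not_le)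
      obtain r where "r \<in> \<rat>" "s < r" "r < t" using Rats_dense_in_real[OF t(2)] by blast
      then show "P s" using elim(1) dc[OF t(1), of r] by auto
    qed
  qed
qed

section \<open>The representation of the delay system\<close>

context delay
begin

definition Q :: "'d \<Rightarrow> 'd \<Rightarrow> distr" where
  "Q i j \<phi> = (if i = j then \<phi> (- L) else 0) - (\<Sum>l=1..N. A l $ i $ j * \<phi> (\<Lambda> l - L))
     - (LINT s|lborel. g s $ i $ j * \<phi> (s - L))"

text \<open>The kernel of Q is the Dirac matrix minus the delay operator, translated by - L, so its
  inverse evaluates at L the solution of the resolvent equation with right-hand side in column j.\<close>

definition Qinv :: "'d \<Rightarrow> 'd \<Rightarrow> distr" where
  "Qinv i j \<phi> = (SOME \<psi>. vanishing \<psi> \<and> (\<forall>x\<ge>L. \<psi> x = \<phi> x *\<^sub>R axis j 1 + K \<psi> x)) L $ i"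

text \<open>Q is a formula on all functions. This lets it be applied to components of resolvent
  solutions, which are only known to be continuous, and lets cutoffs be dropped inside it.\<close>

lemma Q_cong:
  assumes "\<And>y. - L \<le> y \<Longrightarrow> y \<le> 0 \<Longrightarrow> f y = h y"
  shows "Q i j f = Q i j h"
proof -
  have "f (\<Lambda> l - L) = h (\<Lambda> l - L)" if "l \<in> {1..N}" for l
    using delay_pos[OF that] delay_le[OF that] by (intro assms) auto
  then have "(\<Sum>l=1..N. A l $ i $ j * f (\<Lambda> l - L)) = (\<Sum>l=1..N. A l $ i $ j * h (\<Lambda> l - L))"
    by (intro sum.cong) auto
  moreover have "(\<lambda>s. g s $ i $ j * f (s - L)) = (\<lambda>s. g s $ i $ j * h (s - L))"
  proof
    fix s
    show "g s $ i $ j * f (s - L) = g s $ i $ j * h (s - L)"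
      using assms[of "s - L"] g_zero[of s] by (cases "s \<in> {0..L}") auto
  qed
  moreover have "f (- L) = h (- L)" using assms[of "- L"] L_nonneg by simp
  ultimately show ?thesis by (simp only: Q_def)
qed

lemma Q_integrable:
  assumes "continuous_on UNIV f"
  shows "integrable lborel (\<lambda>s. g s $ i $ j * f (x + (s - L)))"
proof -
  have "continuous_on UNIV (\<lambda>y. f y *\<^sub>R axis j (1::real))"
    using assms by (intro continuous_intros)
  from integrable_bounded_linear[OF bounded_linear_vec_nth[of i] K_integrable[OF this, of "x - L"]]
  show ?thesis
    by (simp add: matrix_vector_mul_component inner_axis mult.commute algebra_simps)
qed

text \<open>The bridge from distributions to the resolvent equation: the sum over j reassembles
  matrix-vector products, and the translation in Q becomes evaluation at x - L. Both inverse
  identities rest on it.\<close>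

lemma Q_K:
  assumes "continuous_on UNIV \<psi>"
  shows "(\<Sum>j\<in>UNIV. Q i j (\<lambda>y. \<psi> (x + y) $ j)) = (\<psi> (x - L) - K \<psi> (x - L)) $ i"
proof -
  have c: "continuous_on UNIV (\<lambda>y. \<psi> y $ j)" for j
    using assms by (intro continuous_intros)
  have "(\<Sum>j\<in>UNIV. \<Sum>l=1..N. A l $ i $ j * \<psi> (x + (\<Lambda> l - L)) $ j) = (\<Sum>l=1..N. A l *v \<psi> (x - L +
      \<Lambda> l)) $ i"
    by (subst sum.swap) (simp add: matrix_vector_mult_def algebra_simps)
  moreover have "(\<Sum>j\<in>UNIV. (LINT s|lborel. g s $ i $ j * \<psi> (x + (s - L)) $ j)) =
      (LINT s|lborel. g s *v \<psi> (x - L + s)) $ i"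
  proof -
    have "(\<Sum>j\<in>UNIV. (LINT s|lborel. g s $ i $ j * \<psi> (x + (s - L)) $ j)) =
        (LINT s|lborel. (\<Sum>j\<in>UNIV. g s $ i $ j * \<psi> (x + (s - L)) $ j))"
      by (rule Bochner_Integration.integral_sum[symmetric]) (rule Q_integrable[OF c])
    also have "\<dots> = (LINT s|lborel. (g s *v \<psi> (x - L + s)) $ i)"
      by (simp add: matrix_vector_mult_def algebra_simps)
    also have "\<dots> = (LINT s|lborel. g s *v \<psi> (x - L + s)) $ i"
      by (rule integral_bounded_linear[OF bounded_linear_vec_nth K_integrable[OF assms]])
    finally show ?thesis .
  qed
  moreover have "(\<Sum>j\<in>UNIV. if i = j then \<psi> (x + - L) $ j else 0) = \<psi> (x - L) $ i"
    by simp
  ultimately show ?thesis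
    by (simp add: Q_def sum_subtractf K_def)
qed

lemma radon_Q: "radon (Q i j)"
proof -
  let ?h = "\<lambda>t. g (t + L) $ i $ j"
  have "set_integrable lborel {a..b} ?h" for a b
    unfolding set_integrable_def
  proof (rule Bochner_Integration.integrable_bound)
    show "integrable lborel (\<lambda>t. indicator {a..b} t * C)"
      by (intro integrable_mult_left integrable_indicator_Icc)
    have "\<bar>?h t\<bar> \<le> C" for t
      using component_le_norm_cart[of "g (t +
          L) $ i" j] Finite_Cartesian_Product.norm_nth_le[of "g (t + L)" i] g_bound[of "t + L"]
              by linarith
    then show "AE t in lborel. norm (indicat_real {a..b} t *\<^sub>R ?h t) \<le>
        norm (indicat_real {a..b} t * C)"
      using C_nonneg by (intro AE_I2) (auto simp: indicator_def)
    show "(\<lambda>t. indicat_real {a..b} t *\<^sub>R ?h t) \<in> borel_measurable lborel"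
      by measurable
  qed
  then have 1: "radon (fun_distr ?h)" by (rule radon_fun_distr)
  have "(LINT s|lborel. g s $ i $ j * \<phi> (s - L)) = fun_distr ?h \<phi>" for \<phi>
    unfolding fun_distr_def
    by (subst lborel_integral_real_affine[of 1 _ L]) (simp_all add: add.commute)
  then have eq: "Q i j = (\<lambda>\<phi>. ((if i = j then 1 else 0) * \<phi> (- L) +
      (\<Sum>l=1..N. (- (A l $ i $ j)) * \<phi> (\<Lambda> l - L)))
      + (-1) * fun_distr ?h \<phi>)"
    by (auto simp: Q_def fun_eq_iff sum_negf)
  show ?thesis unfolding eq
    by (intro radon_add_distr radon_cmult_distr radon_sum_distr radon_dirac 1)
qed

lemma distr_cpt_neg_Q: "distr_cpt_neg (Q i j)"
proof -
  have "Q i j \<phi> = 0" if "tsupp \<phi> \<inter> {- L..0} = {}" for \<phi>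
  proof -
    have "Q i j \<phi> = Q i j (\<lambda>x. 0)"
      by (rule Q_cong, rule tsupp_zero) (use that in auto)
    then show ?thesis by (simp add: Q_def)
  qed
  then show ?thesis unfolding distr_cpt_neg_def using radon_is_distr[OF radon_Q] by blast
qed

lemma supp_ge_Q: "supp_ge (Q i j) (- L)"
proof -
  have "Q i j \<phi> = 0" if "tsupp \<phi> \<inter> {- L..} = {}" for \<phi>
  proof -
    have "Q i j \<phi> = Q i j (\<lambda>x. 0)"
      by (rule Q_cong, rule tsupp_zero) (use that in auto)
    then show ?thesis by (simp add: Q_def)
  qed
  then show ?thesis unfolding supp_ge_def by blast
qed

section \<open>The inverse as evaluation of a resolvent solution\<close>

lemma test_resolvent:
  assumes "test_fun \<theta>"
  shows "\<exists>\<psi>. vanishing \<psi> \<and> (\<forall>x. \<psi> x = \<theta> x *\<^sub>R axis j 1 + K \<psi> x)"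
proof -
  obtain B where B: "\<And>x. \<bar>\<theta> x\<bar> \<le> B" using test_fun_bounded[OF assms] by blast
  obtain c where c: "\<And>x. x > c \<Longrightarrow> \<theta> x = 0" using test_fun_zero_above[OF assms] by blast
  show ?thesis
    by (rule resolvent_exists[where B = B and c = c])
       (auto simp: B c intro!: continuous_on_scaleR test_fun_continuous[OF assms])
qed

text \<open>\<open>vanishing_unique\<close> at a = L makes the choice in \<open>Qinv\<close>
  immaterial. Any solution on {L..} may be used, whatever it does further left, where cutoffs
  destroy the equation.\<close>

lemma Qinv_eq:
  assumes "test_fun \<theta>" "vanishing \<psi>" "\<And>x. x \<ge> L \<Longrightarrow> \<psi> x = \<theta> x *\<^sub>R axis j 1 + K \<psi> x"
  shows "Qinv i j \<theta> = \<psi> L $ i"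
proof -
  let ?P = "\<lambda>\<psi>. vanishing \<psi> \<and> (\<forall>x\<ge>L. \<psi> x = \<theta> x *\<^sub>R axis j 1 + K \<psi> x)"
  have "?P \<psi>" using assms by blast
  then have P: "?P (SOME \<psi>. ?P \<psi>)" by (rule someI[of ?P])
  have "(SOME \<psi>. ?P \<psi>) L = \<psi> L"
    by (rule vanishing_unique[OF conjunct1[OF P] assms(2) conjunct2[OF P, rule_format] assms(3) order.refl])
  then show ?thesis by (simp add: Qinv_def)
qed

lemma vanishing_add: "vanishing \<psi> \<Longrightarrow> vanishing \<eta> \<Longrightarrow> vanishing (\<lambda>x. \<psi> x + \<eta> x)"
proof -
  assume a: "vanishing \<psi>" "vanishing \<eta>"
  obtain c1 c2 where "\<forall>x>c1. \<psi> x = 0" "\<forall>x>c2. \<eta> x = 0" using a by (auto simp: vanishing_def)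
  then have "\<forall>x>max c1 c2. \<psi> x + \<eta> x = 0" by auto
  then show ?thesis using a continuous_on_add[of UNIV \<psi> \<eta>] unfolding vanishing_def by blast
qed

lemma vanishing_zero: "vanishing (\<lambda>x. 0)"
  by (simp add: vanishing_def)

lemma vanishing_scaleR: "vanishing \<psi> \<Longrightarrow> vanishing (\<lambda>x. c *\<^sub>R \<psi> x)"
  unfolding vanishing_def by (auto intro: continuous_on_scaleR)

lemma vanishing_sum: "finite I \<Longrightarrow> (\<And>i. vanishing (\<psi> i)) \<Longrightarrow> vanishing (\<lambda>x. \<Sum>i\<in>I. \<psi> i x)"
  by (induction I rule: finite_induct) (simp_all add: vanishing_zero vanishing_add)

lemma vanishing_shift: "vanishing \<psi> \<Longrightarrow> vanishing (\<lambda>y. \<psi> (x + y))"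
proof -
  assume a: "vanishing \<psi>"
  obtain c where c: "\<And>x. x > c \<Longrightarrow> \<psi> x = 0" using a by (auto simp: vanishing_def)
  have "\<forall>y>c - x. \<psi> (x + y) = 0" by (auto intro: c)
  moreover have "continuous_on UNIV (\<lambda>y. \<psi> (x + y))"
    by (rule continuous_on_compose2[of UNIV \<psi>]) (use a in \<open>auto simp: vanishing_def intro: continuous_intros\<close>)
  ultimately show ?thesis unfolding vanishing_def by blast
qed

lemma vanishing_continuous: "vanishing \<psi> \<Longrightarrow> continuous_on UNIV \<psi>"
  by (simp add: vanishing_def)

lemma vanishing_test_fun: "test_fun \<theta> \<Longrightarrow> vanishing (\<lambda>x. \<theta> x *\<^sub>R v)"
  using test_fun_zero_above[of \<theta>]
  by (auto simp: vanishing_def intro!: continuous_on_scaleR test_fun_continuous)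

lemma K_shift: "K (\<lambda>z. \<psi> (x + z)) y = K \<psi> (x + y)"
  by (simp add: K_def add.assoc)

text \<open>Superposition: the solutions for the single columns add up to the one for the vector
  right-hand side, and uniqueness identifies the sum with the given \<open>\<psi>\<close>. This
  reduces both a product with Q and the output formula to exhibiting a solution.\<close>

lemma Qinv_sum_eq:
  assumes \<theta>: "\<And>j. test_fun (\<theta> j)" and \<psi>: "vanishing \<psi>"
    and eq: "\<And>x j. x \<ge> L \<Longrightarrow> \<theta> j x = (\<psi> x - K \<psi> x) $ j"
  shows "(\<Sum>j\<in>UNIV. Qinv i j (\<theta> j)) = \<psi> L $ i"
proof -
  have "\<forall>j. \<exists>\<psi>. vanishing \<psi> \<and> (\<forall>x. \<psi> x = \<theta> j x *\<^sub>R axis j 1 + K \<psi> x)"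
    using test_resolvent[OF \<theta>] by blast
  then obtain \<eta> where \<eta>: "\<And>j. vanishing (\<eta> j)" "\<And>j x. \<eta> j x = \<theta> j x *\<^sub>R axis j 1 + K (\<eta> j) x"
    by metis
  have "(\<Sum>j\<in>UNIV. Qinv i j (\<theta> j)) = (\<Sum>j\<in>UNIV. \<eta> j L $ i)"
    using Qinv_eq[OF \<theta> \<eta>(1) \<eta>(2)] by simp
  also have "\<dots> = (\<Sum>j\<in>UNIV. \<eta> j L) $ i" by simp
  also have "(\<Sum>j\<in>UNIV. \<eta> j L) = \<psi> L"
  proof (rule vanishing_unique[where a = L and \<theta> = "\<lambda>x. \<Sum>j\<in>UNIV. \<theta> j x *\<^sub>R axis j 1"])
    show "vanishing (\<lambda>x. \<Sum>j\<in>UNIV. \<eta> j x)" by (intro vanishing_sum \<eta>) auto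
    show "(\<Sum>j\<in>UNIV. \<eta> j x) = (\<Sum>j\<in>UNIV. \<theta> j x *\<^sub>R axis j 1) + K (\<lambda>x. \<Sum>j\<in>UNIV. \<eta> j x) x" for x
      unfolding K_sum[OF finite vanishing_continuous[OF \<eta>(1)]] sum.distrib[symmetric]
      by (rule sum.cong[OF refl]) (rule \<eta>(2))
    show "\<psi> x = (\<Sum>j\<in>UNIV. \<theta> j x *\<^sub>R axis j 1) + K \<psi> x" if "x \<ge> L" for x
    proof -
      have "(\<Sum>j\<in>UNIV. \<theta> j x *\<^sub>R axis j 1) = (\<Sum>j\<in>UNIV. (\<psi> x - K \<psi> x) $ j *\<^sub>R axis j 1)"
        using eq[OF that] by simp
      also have "\<dots> = \<psi> x - K \<psi> x"
        by (simp add: vec_eq_iff axis_def if_distrib cong: if_cong)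
      finally show ?thesis by simp
    qed
  qed (use \<psi> in auto)
  finally show ?thesis .
qed

text \<open>If the test function vanishes on {L..}, the zero function solves the equation
  there.\<close>

lemma supp_ge_Qinv: "supp_ge (Qinv i j) L"
  unfolding supp_ge_def
proof (intro allI impI)
  fix \<phi> assume \<phi>: "test_fun \<phi>" "tsupp \<phi> \<inter> {L..} = {}"
  have "\<phi> x = 0" if "x \<ge> L" for x by (rule tsupp_zero) (use \<phi> that in auto)
  then show "Qinv i j \<phi> = 0"
    using Qinv_eq[OF \<phi>(1) vanishing_zero, of j i] by (simp add: K_zero)
qed

lemma radon_Qinv: "radon (Qinv i j)"
proof (rule radonI)
  fix \<phi> \<psi> assume t: "test_fun \<phi>" "test_fun \<psi>"
  obtain p where p: "vanishing p" "\<And>x. p x = \<phi> x *\<^sub>R axis j 1 + K p x"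
      using test_resolvent[OF t(1)] by blast
  obtain r where r: "vanishing r" "\<And>x. r x = \<psi> x *\<^sub>R axis j 1 + K r x"
      using test_resolvent[OF t(2)] by blast
  have "Qinv i j (\<lambda>x. \<phi> x + \<psi> x) = (p L + r L) $ i"
  proof (rule Qinv_eq)
    fix x
    show "p x + r x = (\<phi> x + \<psi> x) *\<^sub>R axis j 1 + K (\<lambda>x. p x + r x) x"
      using p(2)[of x] r(2)[of x]
      by (simp add: K_add[OF vanishing_continuous[OF p(1)] vanishing_continuous[OF r(1)]] scaleR_left_distrib)
  qed (use t p(1) r(1) in \<open>auto intro: test_fun_add vanishing_add\<close>)
  then show "Qinv i j (\<lambda>x. \<phi> x + \<psi> x) = Qinv i j \<phi> + Qinv i j \<psi>"
    using Qinv_eq[OF t(1) p, of i] Qinv_eq[OF t(2) r, of i] by simp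
next
  fix c \<phi> assume t: "test_fun \<phi>"
  obtain p where p: "vanishing p" "\<And>x. p x = \<phi> x *\<^sub>R axis j 1 + K p x"
      using test_resolvent[OF t] by blast
  have "Qinv i j (\<lambda>x. c * \<phi> x) = (c *\<^sub>R p L) $ i"
  proof (rule Qinv_eq)
    fix x
    show "c *\<^sub>R p x = (c * \<phi> x) *\<^sub>R axis j 1 + K (\<lambda>x. c *\<^sub>R p x) x"
      unfolding K_scaleR by (subst p(2)) (simp add: scaleR_right_distrib)
  qed (use t p(1) in \<open>auto intro: test_fun_cmult vanishing_scaleR\<close>)
  then show "Qinv i j (\<lambda>x. c * \<phi> x) = c * Qinv i j \<phi>"
    using Qinv_eq[OF t p, of i] by simp
next
  fix a b
  show "\<exists>C. \<forall>\<phi> M. test_fun \<phi> \<longrightarrow> (\<forall>x. \<phi> x \<noteq> 0 \<longrightarrow> a \<le> x \<and> x \<le> b) \<longrightarrow> (\<forall>x. \<bar>\<phi> x\<bar> \<le> M) \<longrightarrow>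
      \<bar>Qinv i j \<phi>\<bar> \<le> C * M"
  \<comment> \<open>The weighted right-hand side is at most exp (rate * b) * M, as its support ends
    at b. The factor 2 is that of \<open>apriori_bound\<close>, and the first factor removes the
    weight at L.\<close>
  proof (intro exI[of _ "exp (- (rate * L)) * (2 * exp (rate * b))"] allI impI)
    fix \<phi> M assume t: "test_fun \<phi>" and s: "\<forall>x. \<phi> x \<noteq> 0 \<longrightarrow> a \<le> x \<and> x \<le> b" and M: "\<forall>x. \<bar>\<phi> x\<bar> \<le> M"
    obtain p where p: "vanishing p" "\<And>x. p x = \<phi> x *\<^sub>R axis j 1 + K p x"
        using test_resolvent[OF t] by blast
    obtain B where B: "\<And>x. x \<ge> L \<Longrightarrow> exp (rate * x) * norm (p x) \<le> B"
      using vanishing_bounded[OF p(1)] by blast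
    have "exp (rate * L) * norm (p L) \<le> 2 * (exp (rate * b) * M)"
    proof (rule apriori_bound[OF vanishing_continuous[OF p(1)] B p(2)])
      fix x
      show "exp (rate * x) * norm (\<phi> x *\<^sub>R axis j (1::real)) \<le> exp (rate * b) * M"
      proof (cases "\<phi> x = 0")
        case True
        then show ?thesis using M[rule_format, of x] by simp
      next
        case False
        then have "x \<le> b" using s by blast
        then show ?thesis using M rate_pos by (simp add: mult_mono)
      qed
    qed auto
    then have "exp (- (rate * L)) * (exp (rate * L) * norm (p L)) \<le>
        exp (- (rate * L)) * (2 * (exp (rate * b) * M))"
      by (intro mult_left_mono) auto
    moreover have "exp (- (rate * L)) * (exp (rate * L) * norm (p L)) = norm (p L)"
      by (simp add: exp_minus)
    moreover have "\<bar>p L $ i\<bar> \<le> norm (p L)" by (rule component_le_norm_cart)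
    ultimately show "\<bar>Qinv i j \<phi>\<bar> \<le> exp (- (rate * L)) * (2 * exp (rate * b)) * M"
      using Qinv_eq[OF t p, of i] by (simp add: mult.assoc)
  qed
qed

section \<open>The two inverse identities\<close>

lemma radon_plus_Qinv: "radon_plus (Qinv i j)"
  unfolding radon_plus_def using radon_Qinv supp_ge_Qinv by blast

text \<open>K commutes with translations, so correlating \<open>\<phi>\<close> with column k of
  \<open>Qinv\<close> gives the resolvent solution translated by L. Applying Q undoes the resolvent
  and the translation, leaving \<open>\<phi>\<close> at 0.\<close>

lemma Q_Qinv:
  assumes \<phi>: "test_fun \<phi>"
  shows "mconv Q Qinv i k \<phi> = dirac_id i k \<phi>"
proof -
  obtain c where c: "\<And>x. x > c \<Longrightarrow> \<phi> x = 0" using test_fun_zero_above[OF \<phi>] by blast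
  \<comment> \<open>The maximum with 0 makes w1 equal to 1 on all of [- L, 0], where Q looks, even
    if c - L + 1 is negative.\<close>
  obtain w1 where w1: "test_fun w1" "\<And>x. - L - 1 \<le> x \<Longrightarrow> x \<le> max 0 (c - L + 1) \<Longrightarrow> w1 x = 1"
    using cutoff_exists by blast
  obtain w2 where w2: "test_fun w2" "\<And>x. L - 1 \<le> x \<Longrightarrow> x \<le> c + L + 1 \<Longrightarrow> w2 x = 1"
    using cutoff_exists by blast
  obtain \<psi> where \<psi>: "vanishing \<psi>" "\<And>x. \<psi> x = \<phi> x *\<^sub>R axis k 1 + K \<psi> x"
    using test_resolvent[OF \<phi>] by blast
  have "conv (Q i j) (Qinv j k) \<phi> = Q i j (\<lambda>x. \<psi> (L + x) $ j)" for j
  proof -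
    have "conv (Q i j) (Qinv j k) \<phi> = Q i j (\<lambda>x. w1 x * Qinv j k (\<lambda>y. w2 y * \<phi> (x + y)))"
      by (rule conv_value[OF radon_Q supp_ge_Q radon_Qinv supp_ge_Qinv \<phi> c w1(1) w2(1)])
         (auto intro: w1 w2)
    also have "\<dots> = Q i j (\<lambda>x. \<psi> (L + x) $ j)"
    proof (rule Q_cong)
      fix x assume x: "- L \<le> x" "x \<le> 0"
      have "Qinv j k (\<lambda>y. w2 y * \<phi> (x + y)) = \<psi> (x + L) $ j"
      proof (rule Qinv_eq[OF test_fun_cutoff_shift[OF w2(1) \<phi>] vanishing_shift[OF \<psi>(1)]])
        fix y assume y: "L \<le> y"
        have "w2 y * \<phi> (x + y) = \<phi> (x + y)"
        proof (cases "x + y > c")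
          case False
          then have "w2 y = 1" using x y by (intro w2) auto
          then show ?thesis by simp
        qed (simp add: c)
        then show "\<psi> (x + y) = (w2 y * \<phi> (x + y)) *\<^sub>R axis k 1 + K (\<lambda>y. \<psi> (x + y)) y"
          unfolding K_shift using \<psi>(2) by metis
      qed
      moreover have "w1 x = 1" using x by (intro w1) auto
      ultimately show "w1 x * Qinv j k (\<lambda>y. w2 y * \<phi> (x + y)) = \<psi> (L + x) $ j"
        by (simp add: add.commute)
    qed
    finally show ?thesis .
  qed
  then have "mconv Q Qinv i k \<phi> = (\<psi> (L - L) - K \<psi> (L - L)) $ i"
    unfolding mconv_def using Q_K[OF vanishing_continuous[OF \<psi>(1)], of i L] by simp
  also have "\<psi> (L - L) - K \<psi> (L - L) = \<phi> 0 *\<^sub>R axis k 1"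
    using \<psi>(2)[of 0] by simp
  finally show ?thesis
    by (simp add: dirac_id_def dirac0_def zero_distr_def axis_def)
qed

text \<open>In this order the solution is known beforehand: on {L..} the correlation with column k
  of Q is the right-hand side produced by \<open>\<phi>\<close> times the k-th unit vector,
  translated by L. Evaluation at L returns \<open>\<phi>\<close> at 0.\<close>

lemma Qinv_Q:
  assumes \<phi>: "test_fun \<phi>"
  shows "mconv Qinv Q i k \<phi> = dirac_id i k \<phi>"
proof -
  obtain c where c: "\<And>x. x > c \<Longrightarrow> \<phi> x = 0" using test_fun_zero_above[OF \<phi>] by blast
  obtain w1 where w1: "test_fun w1" "\<And>x. L - 1 \<le> x \<Longrightarrow> x \<le> c + L + 1 \<Longrightarrow> w1 x = 1"
    using cutoff_exists by blast
  obtain w2 where w2: "test_fun w2" "\<And>x. - L - 1 \<le> x \<Longrightarrow> x \<le> c - L + 1 \<Longrightarrow> w2 x = 1"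
    using cutoff_exists by blast
  define \<theta> where "\<theta> j = (\<lambda>x. w1 x * Q j k (\<lambda>y. w2 y * \<phi> (x + y)))" for j
  define \<eta> where "\<eta> = (\<lambda>x. \<phi> x *\<^sub>R axis k (1::real) :: real^'d)"
  have \<eta>: "vanishing \<eta>" unfolding \<eta>_def by (rule vanishing_test_fun[OF \<phi>])
  have "conv (Qinv i j) (Q j k) \<phi> = Qinv i j (\<theta> j)" for j
    unfolding \<theta>_def
    by (rule conv_value[OF radon_Qinv supp_ge_Qinv radon_Q supp_ge_Q \<phi> c w1(1) w2(1)])
       (auto intro: w1 w2)
  moreover have "(\<Sum>j\<in>UNIV. Qinv i j (\<theta> j)) = \<eta> (- L + L) $ i"
  proof (rule Qinv_sum_eq[OF _ vanishing_shift[OF \<eta>]])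
    show "test_fun (\<theta> j)" for j
      unfolding \<theta>_def by (rule test_fun_radon_shift[OF radon_Q w1(1) w2(1) \<phi>])
    fix x j assume x: "L \<le> x"
    have "\<theta> j x = Q j k (\<lambda>y. \<phi> (x + y))"
    proof -
      have "Q j k (\<lambda>y. w2 y * \<phi> (x + y)) = Q j k (\<lambda>y. \<phi> (x + y))"
      proof (rule Q_cong)
        fix y assume y: "- L \<le> y" "y \<le> 0"
        show "w2 y * \<phi> (x + y) = \<phi> (x + y)"
        proof (cases "x + y > c")
          case False
          then have "w2 y = 1" using x y by (intro w2) auto
          then show ?thesis by simp
        qed (simp add: c)
      qed
      moreover have "w1 x * Q j k (\<lambda>y. \<phi> (x + y)) = Q j k (\<lambda>y. \<phi> (x + y))"
      proof (cases "x \<le> c + L + 1")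
        case True
        then have "w1 x = 1" using x by (intro w1) auto
        then show ?thesis by simp
      next
        case False
        \<comment> \<open>Q reads only y \<ge> - L, and then x + y exceeds c + 1.\<close>
        have "Q j k (\<lambda>y. \<phi> (x + y)) = Q j k (\<lambda>y. 0)"
          by (rule Q_cong) (use False in \<open>auto intro: c\<close>)
        also have "\<dots> = 0" by (simp add: Q_def)
        finally show ?thesis by simp
      qed
      ultimately show ?thesis by (simp add: \<theta>_def)
    qed
    also have "\<dots> = (\<Sum>l\<in>UNIV. Q j l (\<lambda>y. \<eta> (x + y) $ l))"
    proof -
      have "Q j l (\<lambda>y. \<eta> (x + y) $ l) = (if l = k then Q j k (\<lambda>y. \<phi> (x + y)) else 0)" for l
        by (auto simp: \<eta>_def axis_def Q_def)
      then show ?thesis by simp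
    qed
    also have "\<dots> = (\<eta> (- L + x) - K (\<lambda>y. \<eta> (- L + y)) x) $ j"
      unfolding K_shift using Q_K[OF vanishing_continuous[OF \<eta>], of j x] by simp
    finally show "\<theta> j x = (\<eta> (- L + x) - K (\<lambda>y. \<eta> (- L + y)) x) $ j" .
  qed
  ultimately have "mconv Qinv Q i k \<phi> = \<eta> 0 $ i" by (simp add: mconv_def)
  then show ?thesis
    by (simp add: \<eta>_def dirac_id_def dirac0_def zero_distr_def axis_def)
qed

end

section \<open>Correlations of test functions with solutions\<close>

context delay
begin

definition correlate :: "(real \<Rightarrow> real) \<Rightarrow> (real \<Rightarrow> real^'d) \<Rightarrow> real \<Rightarrow> real^'d" where
  "correlate \<phi> X t = (LINT s|lborel. \<phi> (t + s) *\<^sub>R X s)"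

lemma correlate_integrable:
  fixes X :: "real \<Rightarrow> real^'n"
  assumes X: "\<And>a b. set_integrable lborel {a..b} X" and \<phi>: "test_fun \<phi>"
  shows "integrable lborel (\<lambda>s. \<phi> (t + s) *\<^sub>R X s)"
proof -
  obtain a b where "\<And>s. \<phi> (t + s) \<noteq> 0 \<Longrightarrow> a \<le> s \<and> s \<le> b"
    using test_fun_support[OF test_fun_shift[OF \<phi>]] by blast
  from integrable_cutoff(1)[OF X test_fun_continuous[OF test_fun_shift[OF \<phi>]] this]
  show ?thesis .
qed

text \<open>Substituting s + r for s turns the delay of X into an advance of the correlation
  variable.\<close>

lemma correlate_delay:
  assumes X: "\<And>a b. set_integrable lborel {a..b} X" and \<phi>: "test_fun \<phi>"
  shows "integrable lborel (\<lambda>s. \<phi> (t + s) *\<^sub>R (M *v X (s - r)))"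
    and "(LINT s|lborel. \<phi> (t + s) *\<^sub>R (M *v X (s - r))) = M *v correlate \<phi> X (t + r)"
proof -
  have bl: "bounded_linear (\<lambda>v. M *v v)" by (rule matrix_vector_mul_bounded_linear)
  note i = correlate_integrable[OF X \<phi>, of "t + r"]
  have eq: "(\<lambda>s. \<phi> (t + r + (- r + 1 * s)) *\<^sub>R X (- r + 1 * s)) = (\<lambda>s. \<phi> (t + s) *\<^sub>R X (s - r))"
    by (simp add: algebra_simps)
  have 1: "integrable lborel (\<lambda>s. \<phi> (t + s) *\<^sub>R X (s - r))"
    using lborel_integrable_real_affine[OF i, of 1 "- r"] unfolding eq by simp
  have 2: "(LINT s|lborel. \<phi> (t + s) *\<^sub>R X (s - r)) = correlate \<phi> X (t + r)"
    unfolding correlate_def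
    using lborel_integral_real_affine[of 1 "\<lambda>s. \<phi> (t + r + s) *\<^sub>R X s" "- r"] unfolding eq by simp
  have eq2: "(\<lambda>s. \<phi> (t + s) *\<^sub>R (M *v X (s - r))) = (\<lambda>s. M *v (\<phi> (t + s) *\<^sub>R X (s - r)))"
    by (simp add: matrix_vector_mult_scaleR)
  show "integrable lborel (\<lambda>s. \<phi> (t + s) *\<^sub>R (M *v X (s - r)))"
    unfolding eq2 by (rule integrable_bounded_linear[OF bl 1])
  show "(LINT s|lborel. \<phi> (t + s) *\<^sub>R (M *v X (s - r))) = M *v correlate \<phi> X (t + r)"
    unfolding eq2 2[symmetric] by (rule integral_bounded_linear[OF bl 1])
qed

text \<open>Fubini, followed by the point delay rule for each fixed r. The work is in absolute
  integrability over the product.\<close>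

lemma correlate_distributed_delay:
  assumes X: "\<And>a b. set_integrable lborel {a..b} X" and [measurable]: "X \<in> borel_measurable borel"
    and \<phi>: "test_fun \<phi>"
  shows "integrable lborel (\<lambda>s. \<phi> (t + s) *\<^sub>R (LINT r|lborel. g r *v X (s - r)))"
    and "(LINT s|lborel. \<phi> (t + s) *\<^sub>R (LINT r|lborel. g r *v X (s - r))) =
      (LINT r|lborel. g r *v correlate \<phi> X (t + r))"
proof -
  have [measurable]: "\<phi> \<in> borel_measurable borel"
    by (rule borel_measurable_continuous_onI[OF test_fun_continuous[OF \<phi>]])
  obtain a b where ab: "\<And>x. \<phi> x \<noteq> 0 \<Longrightarrow> a \<le> x \<and> x \<le> b" using test_fun_support[OF \<phi>] by blast
  obtain M where M: "M \<ge> 0" "\<And>x. \<bar>\<phi> x\<bar> \<le> M" using test_fun_bounded[OF \<phi>] by blast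
  \<comment> \<open>I contains every s with t + r + s in [a, b] for some r in [0, L]. Thus H bounds
    the inner integrals uniformly in r, up to the factor C * M.\<close>
  define I where "I = {a - t - L..b - t}"
  define H where "H = (LINT s|lborel. norm (indicator I s *\<^sub>R X s))"
  have iI: "integrable lborel (\<lambda>s. norm (indicator I s *\<^sub>R X s))"
    using X[of "a - t - L" "b - t"] unfolding I_def set_integrable_def by (rule integrable_norm)
  define f where "f r s = \<phi> (t + s) *\<^sub>R (g r *v X (s - r))" for r s
  have [measurable]: "case_prod f \<in> borel_measurable (lborel \<Otimes>\<^sub>M lborel)"
    unfolding f_def case_prod_beta by measurable
  have norm_f: "(LINT s|lborel. norm (f r s)) \<le> indicator {0..L} r * (C * (M * H))" for r
  proof (cases "r \<in> {0..L}")
    case True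
    have "(LINT s|lborel. norm (f r s)) \<le> (LINT s|lborel. C * norm (\<phi> (t + s) *\<^sub>R X (s - r)))"
    proof (rule integral_mono)
      show "integrable lborel (\<lambda>s. norm (f r s))"
        unfolding f_def by (intro integrable_norm correlate_delay X \<phi>)
      show "integrable lborel (\<lambda>s. C * norm (\<phi> (t + s) *\<^sub>R X (s - r)))"
        using correlate_delay(1)[OF X \<phi>, where M = "mat 1"]
        by (intro integrable_mult_right integrable_norm) simp
      fix s
      have "norm (f r s) = \<bar>\<phi> (t + s)\<bar> * norm (g r *v X (s - r))" by (simp add: f_def)
      also have "\<dots> \<le> \<bar>\<phi> (t + s)\<bar> * (norm (g r) * norm (X (s - r)))"
        by (intro mult_left_mono norm_matrix_vector_mult_le) auto
      also have "\<dots> \<le> \<bar>\<phi> (t + s)\<bar> * (C * norm (X (s - r)))"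
        by (intro mult_left_mono mult_right_mono g_bound) auto
      finally show "norm (f r s) \<le> C * norm (\<phi> (t + s) *\<^sub>R X (s - r))"
        by (simp add: mult.left_commute)
    qed
    also have "\<dots> = C * (LINT s|lborel. norm (\<phi> (t + s) *\<^sub>R X (s - r)))"
      by (rule integral_mult_right_zero)
    also have "(LINT s|lborel. norm (\<phi> (t + s) *\<^sub>R X (s - r))) = (LINT s|lborel. norm (\<phi> (t +
        r + s) *\<^sub>R X s))"
      using lborel_integral_real_affine[of 1 "\<lambda>s. norm (\<phi> (t + r + s) *\<^sub>R X s)" "- r"]
      by (simp add: algebra_simps)
    also have "C * \<dots> \<le> C * (LINT s|lborel. M * norm (indicator I s *\<^sub>R X s))"
    proof (intro mult_left_mono integral_mono C_nonneg)
      show "integrable lborel (\<lambda>s. norm (\<phi> (t + r + s) *\<^sub>R X s))"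
        by (intro integrable_norm correlate_integrable X \<phi>)
      show "integrable lborel (\<lambda>s. M * norm (indicator I s *\<^sub>R X s))"
        by (intro integrable_mult_right iI)
      fix s
      show "norm (\<phi> (t + r + s) *\<^sub>R X s) \<le> M * norm (indicator I s *\<^sub>R X s)"
      proof (cases "s \<in> I")
        case True
        then show ?thesis using M(2)[of "t + r + s"] by (simp add: mult_right_mono)
      next
        case False
        then have "\<not> (a \<le> t + r + s \<and> t + r + s \<le> b)" using \<open>r \<in> {0..L}\<close> by (auto simp: I_def)
        then have "\<phi> (t + r + s) = 0" using ab by blast
        then show ?thesis using M(1) by simp
      qed
    qed
    finally show ?thesis using True by (simp add: H_def)
  qed (simp add: f_def g_zero)
  have int: "integrable (lborel \<Otimes>\<^sub>M lborel) (case_prod f)"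
  proof (rule lborel_pair.Fubini_integrable)
    show "integrable lborel (\<lambda>r. LINT s|lborel. norm (case (r, s) of (r, s) \<Rightarrow> f r s))"
    proof (rule Bochner_Integration.integrable_bound)
      show "integrable lborel (\<lambda>r. indicator {0..L} r * (C * (M * H)))"
        by (intro integrable_mult_left integrable_indicator_Icc)
      have "0 \<le> (LINT s|lborel. norm (f r s))" for r by (rule integral_nonneg_AE) simp
      then show "AE r in lborel. norm (LINT s|lborel. norm (case (r, s) of (r, s) \<Rightarrow> f r s))
          \<le> norm (indicator {0..L} r * (C * (M * H)))"
        using norm_f order_trans[OF norm_f abs_ge_self] by (intro AE_I2) simp
    qed measurable
    show "AE r in lborel. integrable lborel (\<lambda>s. case (r, s) of (r, s) \<Rightarrow> f r s)"
      unfolding f_def by (intro AE_I2) (simp add: correlate_delay X \<phi>)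
  qed simp
  have eq: "(\<lambda>s. \<phi> (t + s) *\<^sub>R (LINT r|lborel. g r *v X (s - r))) = (\<lambda>s. LINT r|lborel. f r s)"
    by (simp add: f_def)
  show "integrable lborel (\<lambda>s. \<phi> (t + s) *\<^sub>R (LINT r|lborel. g r *v X (s - r)))"
    unfolding eq by (rule lborel_pair.integrable_snd[OF int])
  have "(LINT s|lborel. (LINT r|lborel. f r s)) = (LINT r|lborel. (LINT s|lborel. f r s))"
    by (rule lborel_pair.Fubini_integral[OF int])
  also have "\<dots> = (LINT r|lborel. g r *v correlate \<phi> X (t + r))"
    unfolding f_def by (simp add: correlate_delay X \<phi>)
  finally show "(LINT s|lborel. \<phi> (t + s) *\<^sub>R (LINT r|lborel. g r *v X (s - r))) =
      (LINT r|lborel. g r *v correlate \<phi> X (t + r))"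
    unfolding eq .
qed

text \<open>Integrating the system equation against \<open>\<phi>\<close> translated by t converts
  its delays into the advances that make up K.\<close>

lemma correlate_solution:
  assumes X: "\<And>a b. set_integrable lborel {a..b} X" and Xm[measurable]: "X \<in> borel_measurable borel"
    and F: "\<And>a b. set_integrable lborel {a..b} F" and [measurable]: "F \<in> borel_measurable borel"
    and eq: "AE s in lborel. X s = (\<Sum>j=1..N. A j *v X (s - \<Lambda> j)) +
        (LINT r|lborel. g r *v X (s - r)) + F s"
    and \<phi>: "test_fun \<phi>"
  shows "correlate \<phi> X t = correlate \<phi> F t + K (correlate \<phi> X) t"
proof -
  have [measurable]: "\<phi> \<in> borel_measurable borel"
    by (rule borel_measurable_continuous_onI[OF test_fun_continuous[OF \<phi>]])
  note int = correlate_delay[OF X \<phi>, of t] correlate_distributed_delay[OF X Xm \<phi>, of t]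
    correlate_integrable[OF F \<phi>, of t]
  have "correlate \<phi> X t = (LINT s|lborel. (\<Sum>j=1..N. \<phi> (t + s) *\<^sub>R (A j *v X (s - \<Lambda> j)))
      + \<phi> (t + s) *\<^sub>R (LINT r|lborel. g r *v X (s - r)) + \<phi> (t + s) *\<^sub>R F s)"
    unfolding correlate_def
  proof (rule integral_cong_AE)
    show "AE s in lborel. \<phi> (t + s) *\<^sub>R X s = (\<Sum>j=1..N. \<phi> (t + s) *\<^sub>R (A j *v X (s - \<Lambda> j)))
      + \<phi> (t + s) *\<^sub>R (LINT r|lborel. g r *v X (s - r)) + \<phi> (t + s) *\<^sub>R F s"
      using eq
    proof eventually_elim
      case (elim s)
      show ?case by (subst elim) (simp add: scaleR_right_distrib scaleR_sum_right)
    qed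
  qed measurable
  also have "\<dots> = (\<Sum>j=1..N. A j *v correlate \<phi> X (t + \<Lambda> j)) +
      (LINT r|lborel. g r *v correlate \<phi> X (t + r))
      + correlate \<phi> F t"
    by (simp add: int correlate_def[of \<phi> F])
  finally show ?thesis by (simp add: K_def)
qed

text \<open>The zero past of X becomes a zero future of the correlation: s \<ge> \<tau> and t > c -
  \<tau> give t + s > c.\<close>

lemma vanishing_correlate:
  assumes X: "\<And>a b. set_integrable lborel {a..b} X" and Xm[measurable]: "X \<in> borel_measurable borel"
    and X0: "AE s in lborel. s < \<tau> \<longrightarrow> X s = 0" and \<phi>: "test_fun \<phi>"
  shows "vanishing (correlate \<phi> X)"
proof -
  obtain c where c: "\<And>x. x > c \<Longrightarrow> \<phi> x = 0" using test_fun_zero_above[OF \<phi>] by blast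
  have "correlate \<phi> X t = 0" if "t > c - \<tau>" for t
    unfolding correlate_def
  proof (rule integral_eq_zero_AE)
    show "AE s in lborel. \<phi> (t + s) *\<^sub>R X s = 0"
      using X0 by eventually_elim (use that in \<open>auto intro: c\<close>)
  qed
  moreover have "continuous_on UNIV (correlate \<phi> X)"
    unfolding correlate_def[abs_def] by (rule continuous_integral_shift[OF X Xm \<phi>])
  ultimately show ?thesis by (auto simp: vanishing_def)
qed

text \<open>On {L..} the cutoffs have no effect, and the right-hand side is the correlation with F.
  The correlation with X solves that resolvent equation; its value at L, after substitution, is the
  integral of \<open>\<phi>\<close> against X delayed by L.\<close>

lemma Qinv_output:
  assumes X: "\<And>a b. set_integrable lborel {a..b} X" and Xm[measurable]: "X \<in> borel_measurable borel"
    and F: "\<And>a b. set_integrable lborel {a..b} F" and Fm[measurable]: "F \<in> borel_measurable borel"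
    and X0: "AE s in lborel. s < \<tau> \<longrightarrow> X s = 0" and F0: "AE s in lborel. s < \<tau> \<longrightarrow> F s = 0"
    and eq: "AE s in lborel. X s = (\<Sum>j=1..N. A j *v X (s - \<Lambda> j)) +
        (LINT r|lborel. g r *v X (s - r)) + F s"
    and \<phi>: "test_fun \<phi>"
  shows "(\<Sum>j\<in>UNIV. conv (Qinv i j) (fun_distr (\<lambda>t. F t $ j)) \<phi>) =
      (LINT t|lborel. X (t - L) $ i * \<phi> t)"
proof -
  obtain c where c: "\<And>x. x > c \<Longrightarrow> \<phi> x = 0" using test_fun_zero_above[OF \<phi>] by blast
  obtain w1 where w1: "test_fun w1" "\<And>x. L - 1 \<le> x \<Longrightarrow> x \<le> c - \<tau> + 1 \<Longrightarrow> w1 x = 1"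
    using cutoff_exists by blast
  obtain w2 where w2: "test_fun w2" "\<And>x. \<tau> - 1 \<le> x \<Longrightarrow> x \<le> c - L + 1 \<Longrightarrow> w2 x = 1"
    using cutoff_exists by blast
  have [measurable]: "\<phi> \<in> borel_measurable borel" "w2 \<in> borel_measurable borel"
    by (rule borel_measurable_continuous_onI[OF test_fun_continuous], fact)+
  let ?F = "\<lambda>j. fun_distr (\<lambda>t. F t $ j)"
  have rF: "radon (?F j)" for j
    by (rule radon_fun_distr[OF set_integrable_bounded_linear[OF bounded_linear_vec_nth F]])
  have sF: "supp_ge (?F j) \<tau>" for j
    by (rule supp_ge_fun_distr) (use F0 in \<open>auto elim: eventually_mono\<close>)
  define \<theta> where "\<theta> j = (\<lambda>x. w1 x * ?F j (\<lambda>y. w2 y * \<phi> (x + y)))" for j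
  have "conv (Qinv i j) (?F j) \<phi> = Qinv i j (\<theta> j)" for j
    unfolding \<theta>_def
    by (rule conv_value[OF radon_Qinv supp_ge_Qinv rF sF \<phi> c w1(1) w2(1)]) (auto intro: w1 w2)
  moreover have "(\<Sum>j\<in>UNIV. Qinv i j (\<theta> j)) = correlate \<phi> X L $ i"
  proof (rule Qinv_sum_eq[OF _ vanishing_correlate[OF X Xm X0 \<phi>]])
    show "test_fun (\<theta> j)" for j
      unfolding \<theta>_def by (rule test_fun_radon_shift[OF rF w1(1) w2(1) \<phi>])
    fix x j assume x: "L \<le> x"
    have "?F j (\<lambda>y. w2 y * \<phi> (x + y)) = ?F j (\<lambda>y. \<phi> (x + y))"
      unfolding fun_distr_def
    proof (rule integral_cong_AE)
      show "AE y in lborel. F y $ j * (w2 y * \<phi> (x + y)) = F y $ j * \<phi> (x + y)"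
        using F0
      proof eventually_elim
        case (elim y)
        show ?case
        proof (cases "y < \<tau> \<or> x + y > c")
          case True
          then show ?thesis using elim c by auto
        next
          case False
          then have "w2 y = 1" using x by (intro w2) auto
          then show ?thesis by simp
        qed
      qed
    qed measurable
    moreover have "w1 x * ?F j (\<lambda>y. \<phi> (x + y)) = ?F j (\<lambda>y. \<phi> (x + y))"
    proof (cases "x \<le> c - \<tau> + 1")
      case True
      then have "w1 x = 1" using x by (intro w1) auto
      then show ?thesis by simp
    next
      case False
      have "?F j (\<lambda>y. \<phi> (x + y)) = 0"
        unfolding fun_distr_def
      proof (rule integral_eq_zero_AE)
        show "AE y in lborel. F y $ j * \<phi> (x + y) = 0"
          using F0 by eventually_elim (use False in \<open>auto intro: c\<close>)
      qed
      then show ?thesis by simp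
    qed
    ultimately have "\<theta> j x = (LINT y|lborel. (\<phi> (x + y) *\<^sub>R F y) $ j)"
      by (simp add: \<theta>_def fun_distr_def mult.commute)
    also have "\<dots> = correlate \<phi> F x $ j"
      unfolding correlate_def
      by (rule integral_bounded_linear[OF bounded_linear_vec_nth correlate_integrable[OF F \<phi>]])
    also have "correlate \<phi> F x = correlate \<phi> X x - K (correlate \<phi> X) x"
      using correlate_solution[OF X Xm F Fm eq \<phi>, of x] by simp
    finally show "\<theta> j x = (correlate \<phi> X x - K (correlate \<phi> X) x) $ j" .
  qed
  moreover have "correlate \<phi> X L $ i = (LINT t|lborel. X (t - L) $ i * \<phi> t)"
  proof -
    have "correlate \<phi> X L $ i = (LINT s|lborel. (\<phi> (L + s) *\<^sub>R X s) $ i)"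
      unfolding correlate_def
      by (rule integral_bounded_linear[OF bounded_linear_vec_nth correlate_integrable[OF X \<phi>], symmetric])
    also have "\<dots> = (LINT t|lborel. X (t - L) $ i * \<phi> t)"
      using lborel_integral_real_affine[of 1 "\<lambda>s. (\<phi> (L + s) *\<^sub>R X s) $ i" "- L"]
      by (simp add: mult.commute)
    finally show ?thesis .
  qed
  ultimately show ?thesis by simp
qed

end

section \<open>The input side and the passage to the given system\<close>

lemma before_supp_lower: "t \<in> before_supp u \<Longrightarrow> s \<le> t \<Longrightarrow> s \<in> before_supp u"
  unfolding before_supp_def by (auto elim!: eventually_mono)

text \<open>Each time in \<open>before_supp u\<close> brings its own null set;
  \<open>AE_below_lower_set\<close> merges them into one.\<close>

lemma AE_before_supp: "AE t in lborel. t \<in> before_supp u \<longrightarrow> u t = 0"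
  by (rule AE_below_lower_set) (auto intro: before_supp_lower simp: before_supp_def)

lemma mvconv_dirac:
  fixes B :: "real^'m^'d" and u :: "real \<Rightarrow> real^'m"
  assumes ui: "\<And>a b. set_integrable lborel {a..b} u"
      and um[measurable]: "u \<in> borel_measurable borel"
    and u0: "AE s in lborel. s < \<tau> \<longrightarrow> u s = 0" and \<phi>: "test_fun \<phi>"
  shows "mvconv (\<lambda>i k \<psi>. B $ i $ k * \<psi> 0) (\<lambda>k. fun_distr (\<lambda>t. u t $ k)) j \<phi> =
      fun_distr (\<lambda>t. (B *v u t) $ j) \<phi>"
proof -
  obtain c where c: "\<And>x. x > c \<Longrightarrow> \<phi> x = 0" using test_fun_zero_above[OF \<phi>] by blast
  \<comment> \<open>The maximum with 0 forces w1 = 1 at 0, the only point the Dirac mass reads, even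
    if c - \<tau> + 1 is negative.\<close>
  obtain w1 where w1: "test_fun w1" "\<And>x. - 1 \<le> x \<Longrightarrow> x \<le> max 0 (c - \<tau> + 1) \<Longrightarrow> w1 x = 1"
    using cutoff_exists by blast
  obtain w2 where w2: "test_fun w2" "\<And>x. \<tau> - 1 \<le> x \<Longrightarrow> x \<le> c + 1 \<Longrightarrow> w2 x = 1"
    using cutoff_exists by blast
  have [measurable]: "\<phi> \<in> borel_measurable borel" "w2 \<in> borel_measurable borel"
    by (rule borel_measurable_continuous_onI[OF test_fun_continuous], fact)+
  have uk: "set_integrable lborel {a..b} (\<lambda>t. u t $ k)" for a b k
    by (rule set_integrable_bounded_linear[OF bounded_linear_vec_nth ui])
  have "conv (\<lambda>\<psi>. B $ j $ k * \<psi> 0) (fun_distr (\<lambda>t. u t $ k)) \<phi> =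
      (LINT t|lborel. B $ j $ k * (u t $ k * \<phi> t))" for k
  proof -
    have "supp_ge (\<lambda>\<psi>. B $ j $ k * \<psi> 0) 0"
      unfolding supp_ge_def using tsupp_zero by fastforce
    moreover have "supp_ge (fun_distr (\<lambda>t. u t $ k)) \<tau>"
      by (rule supp_ge_fun_distr) (use u0 in \<open>auto elim: eventually_mono\<close>)
    ultimately have "conv (\<lambda>\<psi>. B $ j $ k * \<psi> 0) (fun_distr (\<lambda>t. u t $ k)) \<phi> =
        B $ j $ k * (w1 0 * fun_distr (\<lambda>t. u t $ k) (\<lambda>y. w2 y * \<phi> (0 + y)))"
      by (intro conv_value[OF radon_cmult_distr[OF radon_dirac] _ radon_fun_distr[OF uk] _ \<phi> c w1(1) w2(1)])
         (auto intro: w1 w2)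
    moreover have "w1 0 = 1" by (intro w1) auto
    moreover have "fun_distr (\<lambda>t. u t $ k) (\<lambda>y. w2 y * \<phi> y) = (LINT t|lborel. u t $ k * \<phi> t)"
      unfolding fun_distr_def
    proof (rule integral_cong_AE)
      show "AE y in lborel. u y $ k * (w2 y * \<phi> y) = u y $ k * \<phi> y"
        using u0
      proof eventually_elim
        case (elim y)
        show ?case
        proof (cases "y < \<tau> \<or> y > c")
          case True
          then show ?thesis using elim c by auto
        next
          case False
          then have "w2 y = 1" by (intro w2) auto
          then show ?thesis by simp
        qed
      qed
    qed measurable
    ultimately show ?thesis by simp
  qed
  then have "mvconv (\<lambda>i k \<psi>. B $ i $ k * \<psi> 0) (\<lambda>k. fun_distr (\<lambda>t. u t $ k)) j \<phi> =
      (\<Sum>k\<in>UNIV. (LINT t|lborel. B $ j $ k * (u t $ k * \<phi> t)))"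
    by (simp add: mvconv_def)
  also have "\<dots> = (LINT t|lborel. (\<Sum>k\<in>UNIV. B $ j $ k * (u t $ k * \<phi> t)))"
  proof (rule Bochner_Integration.integral_sum[symmetric])
    fix k
    obtain a b where "\<And>x. \<phi> x \<noteq> 0 \<Longrightarrow> a \<le> x \<and> x \<le> b" using test_fun_support[OF \<phi>] by blast
    from integrable_cutoff(1)[OF uk test_fun_continuous[OF \<phi>] this]
    show "integrable lborel (\<lambda>t. B $ j $ k * (u t $ k * \<phi> t))"
      by (intro integrable_mult_right) (simp add: mult.commute)
  qed
  also have "\<dots> = fun_distr (\<lambda>t. (B *v u t) $ j) \<phi>"
    by (simp add: fun_distr_def matrix_vector_mult_def sum_distrib_right mult.assoc)
  finally show ?thesis .
qed

lemma increasing_delays: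
  fixes \<Lambda> :: "nat \<Rightarrow> real"
  assumes "0 < \<Lambda> 1" "\<And>j. 1 \<le> j \<Longrightarrow> j < N \<Longrightarrow> \<Lambda> j < \<Lambda> (Suc j)" "j \<in> {1..N}"
  shows "0 < \<Lambda> j" "\<Lambda> j \<le> \<Lambda> N"
proof -
  have le: "\<Lambda> i \<le> \<Lambda> k" if "i \<le> k" "1 \<le> i" "k \<le> N" for i k
    using that(1,3)
  proof (induction k rule: dec_induct)
    case (step k)
    then have "\<Lambda> k < \<Lambda> (Suc k)" using that(2) by (intro assms(2)) auto
    then show ?case using step by auto
  qed simp
  show "0 < \<Lambda> j" using le[of 1 j] assms by auto
  show "\<Lambda> j \<le> \<Lambda> N" using le[of j N] assms by auto
qed

theorem theorem5:
  fixes N :: nat and \<Lambda> :: "nat \<Rightarrow> real" and A :: "nat \<Rightarrow> real^'d::finite^'d"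
    and B :: "real^'m::finite^'d" and g :: "real \<Rightarrow> real^'d^'d" and q :: real
  assumes "N \<ge> 1"
    and "0 < \<Lambda> 1" and "\<And>j. 1 \<le> j \<Longrightarrow> j < N \<Longrightarrow> \<Lambda> j < \<Lambda> (Suc j)"
    and "set_borel_measurable lborel {0..\<Lambda> N} g"
    and "\<exists>C. AE s in lborel. s \<in> {0..\<Lambda> N} \<longrightarrow> norm (g s) \<le> C"
    and "1 \<le> q"
  shows "\<exists>(Q :: 'd \<Rightarrow> 'd \<Rightarrow> distr) (P :: 'd \<Rightarrow> 'm \<Rightarrow> distr) (Qinv :: 'd \<Rightarrow> 'd \<Rightarrow> distr).
     (\<forall>i j. distr_cpt_neg (Q i j)) \<and> (\<forall>i k. distr_cpt_neg (P i k)) \<and>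
     (\<forall>i j. distr_plus (Qinv i j)) \<and>
     (\<forall>i j. distr_eq (mconv Qinv Q i j) (dirac_id i j)) \<and>
     (\<forall>i j. distr_eq (mconv Q Qinv i j) (dirac_id i j)) \<and>
     distr_order_zero (distr_det Qinv) \<and>
     (\<forall>u \<in> Omega_q q. \<forall>x. is_solution q N \<Lambda> A g B u x \<longrightarrow>
        (\<forall>i \<phi>. test_fun \<phi> \<longrightarrow> tsupp \<phi> \<subseteq> {0<..} \<longrightarrow>
           mvconv Qinv (mvconv P (\<lambda>k. fun_distr (\<lambda>t. u t $ k))) i \<phi>
             = (LINT t|lborel. x (t - \<Lambda> N) $ i * \<phi> t)))"
proof -
  obtain C0 where C0: "AE s in lborel. s \<in> {0..\<Lambda> N} \<longrightarrow> norm (g s) \<le> C0" using assms(5) by blast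
  \<comment> \<open>Nonnegative, so that the value 0 given to g' where the bound fails still
    respects it.\<close>
  define C where "C = max C0 0"
  define h where "h s = indicator {0..\<Lambda> N} s *\<^sub>R g s" for s
  \<comment> \<open>Turns the essential bound into a bound at every point by a change on a null set,
    as the locale requires.\<close>
  define g' where "g' s = (if norm (h s) \<le> C then h s else 0)" for s
  have hm[measurable]: "h \<in> borel_measurable borel"
    using assms(4) by (simp add: set_borel_measurable_def h_def[abs_def])
  have g'm[measurable]: "g' \<in> borel_measurable borel"
    unfolding g'_def[abs_def] by measurable
  have g'h: "AE s in lborel. g' s = h s"
    using C0 by eventually_elim (auto simp: g'_def h_def C_def indicator_def)
  have delays: "0 < \<Lambda> j" "\<Lambda> j \<le> \<Lambda> N" if "j \<in> {1..N}" for j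
    using increasing_delays[of \<Lambda> N j] assms(2,3) that by blast+
  interpret delay N \<Lambda> A g' "\<Lambda> N" C
  proof
    show "0 \<le> \<Lambda> N" using delays(1)[of N] assms(1) by (simp add: less_imp_le)
    show "norm (g' s) \<le> C" for s by (simp add: g'_def C_def)
    show "g' s = 0" if "s \<notin> {0..\<Lambda> N}" for s using that by (simp add: g'_def h_def)
  qed (use delays g'm in auto)
  define P where "P = (\<lambda>(i::'d) (k::'m) \<psi>. B $ i $ k * \<psi> (0::real))"
  have io: "mvconv Qinv (mvconv P (\<lambda>k. fun_distr (\<lambda>t. u t $ k))) i \<phi>
      = (LINT t|lborel. x (t - \<Lambda> N) $ i * \<phi> t)"
    if u: "u \<in> Omega_q q" and x: "is_solution q N \<Lambda> A g B u x" and \<phi>: "test_fun \<phi>" for u x i \<phi>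
  proof -
    have um[measurable]: "u \<in> borel_measurable borel" using u by (simp add: Omega_q_def)
    have ui: "set_integrable lborel {a..b} u" for a b
    proof (rule Lq_imp_L1[OF assms(6) um])
      have "integrable lborel (\<lambda>t. norm (u t) powr q)" using u by (simp add: Omega_q_def)
      then show "set_integrable lborel {a..b} (\<lambda>t. norm (u t) powr q)"
        unfolding set_integrable_def by (intro integrable_mult_indicator) auto
    qed
    have xm[measurable]: "x \<in> borel_measurable borel"
        using x by (simp add: is_solution_def Lq_loc_def)
    have xi: "set_integrable lborel {a..b} x" for a b
      using x by (intro Lq_imp_L1[OF assms(6) xm]) (simp add: is_solution_def Lq_loc_def)
    obtain \<tau> where "AE t in lborel. (t < \<tau> \<or> t > 0) \<longrightarrow> u t = 0" using u by (auto simp: Omega_q_def)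
    then have u0: "AE t in lborel. t < \<tau> \<longrightarrow> u t = 0" by eventually_elim auto
    then have \<tau>: "\<tau> \<in> before_supp u" by (simp add: before_supp_def)
    have x_before: "AE t in lborel. t \<in> before_supp u \<longrightarrow> x t = 0"
      using x by (simp add: is_solution_def)
    have x_lt: "AE t in lborel. t < \<sigma> \<longrightarrow> x t = 0" if "\<sigma> \<in> before_supp u" for \<sigma>
      using x_before by eventually_elim (use before_supp_lower[OF that] in auto)
    define F where "F t = B *v u t" for t
    have Fm[measurable]: "F \<in> borel_measurable borel" unfolding F_def[abs_def] by measurable
    have Fi: "set_integrable lborel {a..b} F" for a b
      unfolding F_def[abs_def]
          by (rule set_integrable_bounded_linear[OF matrix_vector_mul_bounded_linear ui])
    have F0: "AE t in lborel. t < \<tau> \<longrightarrow> F t = 0"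
      using u0 by eventually_elim (auto simp: F_def)
    have g_eq: "(LINT s:{0..\<Lambda> N}|lborel. g s *v x (t - s)) =
        (LINT s|lborel. g' s *v x (t - s))" for t
    proof -
      have "(LINT s:{0..\<Lambda> N}|lborel. g s *v x (t - s)) = (LINT s|lborel. h s *v x (t - s))"
        by (simp add: set_lebesgue_integral_def h_def scaleR_matrix_vector_assoc)
      also have "\<dots> = (LINT s|lborel. g' s *v x (t - s))"
      proof (rule integral_cong_AE)
        show "AE s in lborel. h s *v x (t - s) = g' s *v x (t - s)"
          using g'h by eventually_elim simp
      qed measurable
      finally show ?thesis .
    qed
    \<comment> \<open>The system equation is given only outside \<open>before_supp u\<close>. To use
      it on the whole line, all its terms must vanish on that set; for the point delays this holds
      because t - \<open>\<Lambda> j\<close> lies strictly before t.\<close>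
    have delayed: "AE t in lborel. t \<in> before_supp u \<longrightarrow> x (t - \<Lambda> j) = 0" if j: "j \<in> {1..N}" for j
    proof (rule AE_below_lower_set)
      fix \<sigma> assume "\<sigma> \<in> before_supp u"
      from AE_borel_affine[OF _ _ x_lt[OF this], of 1 "- \<Lambda> j"]
      have "AE t in lborel. - \<Lambda> j + 1 * t < \<sigma> \<longrightarrow> x (- \<Lambda> j + 1 * t) = 0" by simp
      then show "AE t in lborel. t < \<sigma> \<longrightarrow> x (t - \<Lambda> j) = 0"
        by eventually_elim (use delays(1)[OF j] in auto)
    qed (rule before_supp_lower)
    \<comment> \<open>Here x (t - s) vanishes for almost every s > 0, the point s = 0 is null, and
      g' is 0 for s < 0.\<close>
    have distributed: "(LINT s|lborel. g' s *v x (t - s)) = 0" if "t \<in> before_supp u" for t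
    proof (rule integral_eq_zero_AE)
      from AE_borel_affine[OF _ _ x_lt[OF that], of "-1" t]
      have "AE s in lborel. t + -1 * s < t \<longrightarrow> x (t + -1 * s) = 0" by simp
      moreover have "AE s in lborel. s \<noteq> (0::real)" by (rule AE_lborel_singleton)
      ultimately show "AE s in lborel. g' s *v x (t - s) = 0"
      proof eventually_elim
        case (elim s)
        show ?case
        proof (cases "s > 0")
          case False
          then have "g' s = 0" using elim(2) by (intro g_zero) auto
          then show ?thesis by simp
        qed (use elim(1) in simp)
      qed
    qed
    have delayed_all: "AE t in lborel. \<forall>j\<in>{1..N}. t \<in> before_supp u \<longrightarrow> x (t - \<Lambda> j) = 0"
      using delayed by (subst AE_ball_countable) auto
    have after: "AE t in lborel. t \<notin> before_supp u \<longrightarrow> x t = (\<Sum>j=1..N. A j *v x (t - \<Lambda> j))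
        + (LINT s:{0..\<Lambda> N}|lborel. g s *v x (t - s)) + B *v u t"
      using x by (simp add: is_solution_def)
    have eq: "AE t in lborel. x t = (\<Sum>j=1..N. A j *v x (t - \<Lambda> j)) +
        (LINT s|lborel. g' s *v x (t - s)) + F t"
      using after delayed_all x_before AE_before_supp[of u]
    proof eventually_elim
      case (elim t)
      show ?case
      proof (cases "t \<in> before_supp u")
        case True
        then have "(\<Sum>j=1..N. A j *v x (t - \<Lambda> j)) = 0" using elim(2) by (intro sum.neutral) auto
        then show ?thesis using elim True distributed by (simp add: F_def)
      next
        case False
        then show ?thesis using elim(1) by (simp add: g_eq F_def)
      qed
    qed
    have Fk: "radon_plus (fun_distr (\<lambda>t. F t $ j))" for j
    proof -
      have "supp_ge (fun_distr (\<lambda>t. F t $ j)) \<tau>"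
        by (rule supp_ge_fun_distr) (use F0 in \<open>auto elim: eventually_mono\<close>)
      moreover have "radon (fun_distr (\<lambda>t. F t $ j))"
        by (rule radon_fun_distr[OF set_integrable_bounded_linear[OF bounded_linear_vec_nth Fi]])
      ultimately show ?thesis by (auto simp: radon_plus_def)
    qed
    have PF: "mvconv P (\<lambda>k. fun_distr (\<lambda>t. u t $ k)) j \<psi> =
        fun_distr (\<lambda>t. F t $ j) \<psi>" if "test_fun \<psi>" for j \<psi>
      unfolding P_def F_def by (rule mvconv_dirac[OF ui um u0 that])
    \<comment> \<open>The product of P with the input agrees with the function distribution of F
      only on test functions, so the replacement under \<open>conv\<close> goes through
      \<open>conv_cong_right\<close>.\<close>
    have "mvconv Qinv (mvconv P (\<lambda>k. fun_distr (\<lambda>t. u t $ k))) i \<phi> =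
        (\<Sum>j\<in>UNIV. conv (Qinv i j) (fun_distr (\<lambda>t. F t $ j)) \<phi>)"
      unfolding mvconv_def[of Qinv]
      using conv_cong_right[OF PF[symmetric] radon_plus_Qinv Fk \<phi>] by simp
    also have "\<dots> = (LINT t|lborel. x (t - \<Lambda> N) $ i * \<phi> t)"
      by (rule Qinv_output[OF xi xm Fi Fm x_lt[OF \<tau>] F0 eq \<phi>])
    finally show ?thesis .
  qed
  have P_cpt: "distr_cpt_neg (P i k)" for i k
  proof -
    have "radon (P i k)" unfolding P_def by (rule radon_cmult_distr[OF radon_dirac])
    moreover have "P i k \<phi> = 0" if "tsupp \<phi> \<inter> {0..0} = {}" for \<phi>
      using that tsupp_zero[of 0 \<phi>] by (auto simp: P_def)
    ultimately show ?thesis unfolding distr_cpt_neg_def using radon_is_distr by blast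
  qed
  show ?thesis
  proof (rule exI[of _ Q], rule exI[of _ P], rule exI[of _ Qinv], intro conjI)
    show "distr_order_zero (distr_det Qinv)" by (rule order_zero_distr_det[OF radon_plus_Qinv])
  qed (use distr_cpt_neg_Q P_cpt radon_plus_distr_plus[OF radon_plus_Qinv] Q_Qinv Qinv_Q io
      in \<open>auto simp: distr_eq_def\<close>)
qed

end
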